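(* Let $L=2U\oplus L_0$ be an even lattice of signature $(2,n)$, $n\ge3$, such that every isotropic subgroup of its discriminant group is cyclic. Let $F$ be a modular form with respect to $\widetilde{\mathrm O}^+(L)$, with Fourier expansion at the standard $0$-dimensional cusp $F(Z)=\sum_{l\in L_1^\vee,\ (l,l)\ge 0}a(l)\exp(2\pi i(l,Z))$. If $a(l)=0$ for all $l$ with $(l,l)=0$, then $F$ is a cusp form.
   Context: $U$ is the hyperbolic plane; the discriminant group is $A_L=L^\vee/L$ with quadratic form $q_L$ with values in $\mathbb Q/2\mathbb Z$, and isotropic means $q_L$ vanishes on the subgroup. $\mathcal D_L$ is one of the two components of $\{[w]\in\mathbb P(L\otimes\mathbb C)\mid (w,w)=0,(w,\bar w)>0\}$, $\widetilde{\mathrm O}^+(L)$ the subgroup of $\mathrm O(L)$ preserving $\mathcal D_L$ and acting trivially on $A_L$. A modular form of weight $k$ (trivial character) is a holomorphic function on the affine cone over $\mathcal D_L$, homogeneous of degree $-k$ and invariant under the group; a cusp form vanishes at all boundary components of the Baily–Borel compactification. The standard $0$-dimensional cusp is defined by a primitive isotropic $u\in L$ with $(u,L)=\mathbb Z$; with $L_1=u^\perp/\mathbb Zu\cong U\oplus L_0$, $\mathcal D_L$ is identified with the tube domain $\mathcal H(L_1)=\{Z\in L_1\otimes\mathbb C\mid (\mathrm{Im} Z,\mathrm{Im} Z)>0\}^+$ (a connected component), on which modular forms are invariant under $Z\mapsto Z+l$, $l\in L_1$, giving the stated Fourier expansion. *)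

theory Defs
  imports "HOL-Analysis.Analysis"
begin

text \<open>Basis of L: e1, f1 (first copy of U), e2, f2 (second copy of U), then a basis of L0
  indexed by the finite type 'm.  Basis of L1 = u^perp / Z u (u = e1): e2, f2, basis of L0.\<close>

datatype 'm idx = E1 | F1 | E2 | F2 | V 'm
datatype 'm idx1 = I1E | I1F | I1V 'm

instance idx :: (finite) finite
proof
  have "(UNIV :: 'a idx set) = {E1, F1, E2, F2} \<union> range V"
    by (auto intro: idx.exhaust)
  then show "finite (UNIV :: 'a idx set)" by (metis finite_Un finite.emptyI finite_insert finite_imageI finite_class.finite_UNIV)
qed

instance idx1 :: (finite) finite
proof
  have "(UNIV :: 'a idx1 set) = {I1E, I1F} \<union> range I1V"
    by (auto intro: idx1.exhaust)
  then show "finite (UNIV :: 'a idx1 set)" by (metis finite_Un finite.emptyI finite_insert finite_imageI finite_class.finite_UNIV)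
qed

definition gramL :: "int^'m^'m \<Rightarrow> real^('m::finite idx)^('m idx)" where
  "gramL G0 = (\<chi> i j. case (i, j) of
      (E1, F1) \<Rightarrow> 1 | (F1, E1) \<Rightarrow> 1 | (E2, F2) \<Rightarrow> 1 | (F2, E2) \<Rightarrow> 1
    | (V a, V b) \<Rightarrow> of_int (G0 $ a $ b) | _ \<Rightarrow> 0)"

definition gramL1 :: "int^'m^'m \<Rightarrow> real^('m::finite idx1)^('m idx1)" where
  "gramL1 G0 = (\<chi> i j. case (i, j) of
      (I1E, I1F) \<Rightarrow> 1 | (I1F, I1E) \<Rightarrow> 1
    | (I1V a, I1V b) \<Rightarrow> of_int (G0 $ a $ b) | _ \<Rightarrow> 0)"

definition rform :: "real^'n^'n \<Rightarrow> real^'n \<Rightarrow> real^'n \<Rightarrow> real" where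
  "rform M x y = x \<bullet> (M *v y)"

definition cform :: "real^'n^'n \<Rightarrow> complex^'n \<Rightarrow> complex^'n \<Rightarrow> complex" where
  "cform M v w = (\<Sum>i\<in>UNIV. \<Sum>j\<in>UNIV. v $ i * complex_of_real (M $ i $ j) * w $ j)"

definition cmv :: "real^'n^'n \<Rightarrow> complex^'n \<Rightarrow> complex^'n" where
  "cmv g w = (\<chi> i. \<Sum>j\<in>UNIV. complex_of_real (g $ i $ j) * w $ j)"

definition cscale :: "complex \<Rightarrow> complex^'n \<Rightarrow> complex^'n" where
  "cscale t w = (\<chi> i. t * w $ i)"

definition cconj :: "complex^'n \<Rightarrow> complex^'n" where
  "cconj w = (\<chi> i. cnj (w $ i))"

definition ImV :: "complex^'n \<Rightarrow> real^'n" where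
  "ImV Z = (\<chi> i. Im (Z $ i))"

definition cvec :: "real^'n \<Rightarrow> complex^'n" where
  "cvec x = (\<chi> i. complex_of_real (x $ i))"

definition latt :: "(real^'n) set" where
  "latt = {v. \<forall>i. v $ i \<in> \<int>}"

definition dual :: "real^'n^'n \<Rightarrow> (real^'n) set" where
  "dual M = {x. \<forall>v\<in>latt. rform M x v \<in> \<int>}"

definition dcoset :: "real^'n \<Rightarrow> (real^'n) set" where
  "dcoset x = (\<lambda>v. x + v) ` latt"

definition discA :: "real^'n^'n \<Rightarrow> (real^'n) set set" where
  "discA M = dcoset ` dual M"

definition cplus :: "(real^'n) set \<Rightarrow> (real^'n) set \<Rightarrow> (real^'n) set" where
  "cplus a b = {x + y | x y. x \<in> a \<and> y \<in> b}"

definition disc_subgroup :: "real^'n^'n \<Rightarrow> (real^'n) set set \<Rightarrow> bool" where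
  "disc_subgroup M H \<longleftrightarrow> H \<subseteq> discA M \<and> latt \<in> H
     \<and> (\<forall>a\<in>H. \<forall>b\<in>H. cplus a b \<in> H) \<and> (\<forall>a\<in>H. uminus ` a \<in> H)"

definition disc_isotropic :: "real^'n^'n \<Rightarrow> (real^'n) set set \<Rightarrow> bool" where
  "disc_isotropic M H \<longleftrightarrow> (\<forall>a\<in>H. \<forall>x\<in>a. \<exists>m::int. rform M x x = 2 * of_int m)"

definition disc_cyclic :: "real^'n^'n \<Rightarrow> (real^'n) set set \<Rightarrow> bool" where
  "disc_cyclic M H \<longleftrightarrow> (\<exists>x\<in>dual M. H = {dcoset (of_int m *\<^sub>R x) | m::int. True})"

definition iso_subgroups_cyclic :: "real^'n^'n \<Rightarrow> bool" where
  "iso_subgroups_cyclic M \<longleftrightarrow>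
     (\<forall>H. disc_subgroup M H \<and> disc_isotropic M H \<longrightarrow> disc_cyclic M H)"

text \<open>The map from L1 (x) C to the affine cone: Z |-> (-(Z,Z)/2) e1 + f1 + Z.\<close>

definition wZ :: "int^'m^'m \<Rightarrow> complex^('m::finite idx1) \<Rightarrow> complex^('m idx)" where
  "wZ G0 Z = (\<chi> i. case i of
      E1 \<Rightarrow> - cform (gramL1 G0) Z Z / 2 | F1 \<Rightarrow> 1
    | E2 \<Rightarrow> Z $ I1E | F2 \<Rightarrow> Z $ I1F | V a \<Rightarrow> Z $ I1V a)"

definition cone0 :: "int^'m^'m \<Rightarrow> (complex^('m::finite idx)) set" where
  "cone0 G0 = {w. cform (gramL G0) w w = 0
       \<and> Im (cform (gramL G0) w (cconj w)) = 0 \<and> Re (cform (gramL G0) w (cconj w)) > 0}"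

definition Z0 :: "complex^('m::finite idx1)" where
  "Z0 = (\<chi> j. if j = I1E \<or> j = I1F then \<i> else 0)"

text \<open>Affine cone over the chosen component D_L (the one corresponding to the tube domain).\<close>

definition coneP :: "int^'m^'m \<Rightarrow> (complex^('m::finite idx)) set" where
  "coneP G0 = connected_component_set (cone0 G0) (wZ G0 Z0)"

definition tube :: "int^'m^'m \<Rightarrow> (complex^('m::finite idx1)) set" where
  "tube G0 = {Z. rform (gramL1 G0) (ImV Z) (ImV Z) > 0 \<and> wZ G0 Z \<in> coneP G0}"

definition posC :: "int^'m^'m \<Rightarrow> (real^('m::finite idx1)) set" where
  "posC G0 = ImV ` tube G0"

definition holo_on :: "(complex^'k \<Rightarrow> complex) \<Rightarrow> (complex^'k) set \<Rightarrow> bool" where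
  "holo_on f S \<longleftrightarrow> (\<forall>z\<in>S. \<exists>D. (f has_derivative D) (at z)
        \<and> (\<forall>v. D (cscale \<i> v) = \<i> * D v))"

definition holo_cone :: "int^'m^'m \<Rightarrow> (complex^('m::finite idx) \<Rightarrow> complex) \<Rightarrow> bool" where
  "holo_cone G0 F \<longleftrightarrow> (\<forall>w\<in>coneP G0. \<exists>U h. open U \<and> w \<in> U \<and> holo_on h U
        \<and> (\<forall>v\<in>U \<inter> coneP G0. F v = h v))"

definition Otilde_plus :: "int^'m^'m \<Rightarrow> (real^('m::finite idx)^('m idx)) set" where
  "Otilde_plus G0 = {g. (\<forall>i j. g $ i $ j \<in> \<int>)
      \<and> transpose g ** gramL G0 ** g = gramL G0
      \<and> (\<lambda>v. g *v v) ` latt = latt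
      \<and> cmv g ` coneP G0 = coneP G0
      \<and> (\<forall>x\<in>dual (gramL G0). g *v x - x \<in> latt)}"

definition OQ_plus :: "int^'m^'m \<Rightarrow> (real^('m::finite idx)^('m idx)) set" where
  "OQ_plus G0 = {g. (\<forall>i j. g $ i $ j \<in> \<rat>)
      \<and> transpose g ** gramL G0 ** g = gramL G0
      \<and> cmv g ` coneP G0 = coneP G0}"

definition modular_form :: "int^'m^'m \<Rightarrow> int \<Rightarrow> (complex^('m::finite idx) \<Rightarrow> complex) \<Rightarrow> bool" where
  "modular_form G0 k F \<longleftrightarrow> holo_cone G0 F
     \<and> (\<forall>w\<in>coneP G0. \<forall>t. t \<noteq> 0 \<longrightarrow> F (cscale t w) = t powi (- k) * F w)
     \<and> (\<forall>g\<in>Otilde_plus G0. \<forall>w\<in>coneP G0. F (cmv g w) = F w)"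

text \<open>Vanishing at all boundary components of the Baily-Borel compactification: after moving
  any rational cusp to the standard one by g in O^+(L (x) Q), the Siegel Phi-operator
  towards every rational isotropic ray c of the closed positive cone (1-dimensional boundary
  components; the 0-dimensional ones lie in their closures) is zero.\<close>

definition vanishes_at_boundary :: "int^'m^'m \<Rightarrow> (complex^('m::finite idx) \<Rightarrow> complex) \<Rightarrow> bool" where
  "vanishes_at_boundary G0 F \<longleftrightarrow>
     (\<forall>g\<in>OQ_plus G0. \<forall>Z\<in>tube G0. \<forall>c::real^('m idx1).
        c \<noteq> 0 \<and> c \<in> latt \<and> rform (gramL1 G0) c c = 0 \<and> c \<in> closure (posC G0) \<longrightarrow>
        ((\<lambda>t::real. F (cmv g (wZ G0 (Z + cscale (\<i> * complex_of_real t) (cvec c)))))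
           \<longlongrightarrow> 0) at_top)"

definition cusp_form :: "int^'m^'m \<Rightarrow> int \<Rightarrow> (complex^('m::finite idx) \<Rightarrow> complex) \<Rightarrow> bool" where
  "cusp_form G0 k F \<longleftrightarrow> modular_form G0 k F \<and> vanishes_at_boundary G0 F"

end

theory Submission
  imports Defs "HOL-Real_Asymp.Real_Asymp"
begin

text \<open>A one-dimensional cusp is a rational isotropic plane \<open>P\<close>. The group \<open>(P \<inter> L\<^sup>\<or>) / (P \<inter> L)\<close> is an isotropic
  subgroup of the discriminant group, hence cyclic, and this forces \<open>P \<inter> L\<close> to contain a vector \<open>e\<close> with
  \<open>(e, L) = \<int>\<close>. By the Eichler criterion the discriminant kernel moves \<open>e\<close> to a multiple of \<open>e1\<close>, so the cusp
  is adjacent to the standard zero-dimensional one, where approaching the boundary means that \<open>Im Z\<close>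
  becomes \<open>Im Z + t d\<close> with \<open>d\<close> isotropic. By the Koecher principle and the hypothesis, only \<open>l\<close> in the open
  positive cone contribute to the Fourier expansion; they satisfy \<open>(l, d) > 0\<close>, so every
  term decays exponentially, dominated by its value at \<open>t = 0\<close>.\<close>

subsection \<open>Coordinates\<close>

text \<open>The cusp condition ranges over flags: \<open>g\<close> carries the line of
  \<open>e1\<close> inside the plane spanned by \<open>e1\<close> and \<open>c\<close>, and that
  line need not be equivalent to the standard one under the discriminant kernel. Only the plane
  matters for the limit. Once some other line of it has been moved to \<open>e1\<close>, both
  direction vectors of the curve are orthogonal to \<open>e1\<close>, so the
  \<open>F1\<close>-coordinate of the moved point is constant and homogeneity turns the curve back
  into one in the tube domain.

  The matrices do not show on which side the new direction \<open>d\<close> lies. Its sign comes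
  from the invariance of \<open>(w, cnj w)\<close>, whose growth along the curve is the same before
  and after the move.

  The condition \<open>(l, l) >= 0\<close> on the Fourier support does not separate the two halves
  of the cone, so the Koecher principle is needed to remove the negative half. All sign arguments
  rest on one fact about \<open>L1\<close>: the orthogonal complement of the isotropic vector
  \<open>e2\<close> is negative semidefinite.\<close>

lemma sum_idx:
  fixes f :: "'m::finite idx \<Rightarrow> 'b::comm_monoid_add"
  shows "sum f UNIV = f E1 + f F1 + f E2 + f F2 + (\<Sum>a\<in>UNIV. f (V a))"
proof -
  have U: "(UNIV :: 'm idx set) = {E1, F1, E2, F2} \<union> range V"
  proof (intro set_eqI iffI)
    show "x \<in> {E1, F1, E2, F2} \<union> range V" for x :: "'m idx" by (cases x) auto
  qed simp
  have "sum f ({E1, F1, E2, F2} \<union> range V) = sum f {E1, F1, E2, F2} + sum f (range V)"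
    by (rule sum.union_disjoint) auto
  moreover have "sum f (range V) = (\<Sum>a\<in>UNIV. f (V a))"
    by (subst sum.reindex) (auto simp: inj_on_def)
  ultimately show ?thesis unfolding U by (simp add: add.assoc)
qed

lemma sum_idx1:
  fixes f :: "'m::finite idx1 \<Rightarrow> 'b::comm_monoid_add"
  shows "sum f UNIV = f I1E + f I1F + (\<Sum>a\<in>UNIV. f (I1V a))"
proof -
  have U: "(UNIV :: 'm idx1 set) = {I1E, I1F} \<union> range I1V"
  proof (intro set_eqI iffI)
    show "x \<in> {I1E, I1F} \<union> range I1V" for x :: "'m idx1" by (cases x) auto
  qed simp
  have "sum f ({I1E, I1F} \<union> range I1V) = sum f {I1E, I1F} + sum f (range I1V)"
    by (rule sum.union_disjoint) auto
  moreover have "sum f (range I1V) = (\<Sum>a\<in>UNIV. f (I1V a))"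
    by (subst sum.reindex) (auto simp: inj_on_def)
  ultimately show ?thesis unfolding U by (simp add: add.assoc)
qed

text \<open>On vectors with \<open>F1\<close>-coordinate 0, the orthogonal complement of
  \<open>e1\<close>, this is the quotient map modulo \<open>e1\<close>; \<open>emb1\<close> is the
  section given by the splitting of \<open>L\<close> into \<open>U\<close> and
  \<open>L1\<close>.\<close>

definition proj1 :: "'a^('m::finite idx) \<Rightarrow> 'a^('m idx1)" where
  "proj1 x = (\<chi> i. case i of I1E \<Rightarrow> x $ E2 | I1F \<Rightarrow> x $ F2 | I1V a \<Rightarrow> x $ V a)"

definition emb1 :: "'a::zero^('m::finite idx1) \<Rightarrow> 'a^('m idx)" where
  "emb1 c = (\<chi> i. case i of E1 \<Rightarrow> 0 | F1 \<Rightarrow> 0 | E2 \<Rightarrow> c $ I1E | F2 \<Rightarrow> c $ I1F | V a \<Rightarrow> c $ I1V a)"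

definition projV :: "'a^('m::finite idx1) \<Rightarrow> 'a^'m" where
  "projV c = (\<chi> a. c $ I1V a)"

lemma proj1_nth [simp]:
  "proj1 x $ I1E = x $ E2" "proj1 x $ I1F = x $ F2" "proj1 x $ I1V a = x $ V a"
  by (simp_all add: proj1_def)

lemma emb1_nth [simp]:
  "emb1 c $ E1 = 0" "emb1 c $ F1 = 0" "emb1 c $ E2 = c $ I1E" "emb1 c $ F2 = c $ I1F"
  "emb1 c $ V a = c $ I1V a"
  by (simp_all add: emb1_def)

lemma projV_nth [simp]: "projV c $ a = c $ I1V a"
  by (simp add: projV_def)

lemma vec_idx_eq_iff:
  fixes x y :: "'a^('m::finite idx)"
  shows "x = y \<longleftrightarrow> x $ E1 = y $ E1 \<and> x $ F1 = y $ F1 \<and> x $ E2 = y $ E2 \<and> x $ F2 = y $ F2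
    \<and> (\<forall>a. x $ V a = y $ V a)"
  unfolding vec_eq_iff by (metis idx.exhaust)

lemma vec_idx1_eq_iff:
  fixes x y :: "'a^('m::finite idx1)"
  shows "x = y \<longleftrightarrow> x $ I1E = y $ I1E \<and> x $ I1F = y $ I1F \<and> (\<forall>a. x $ I1V a = y $ I1V a)"
  unfolding vec_eq_iff by (metis idx1.exhaust)

lemma proj1_emb1 [simp]: "proj1 (emb1 c) = c"
  by (simp add: vec_idx1_eq_iff)

lemma wZ_nth [simp]:
  "wZ G0 Z $ E1 = - cform (gramL1 G0) Z Z / 2" "wZ G0 Z $ F1 = 1" "wZ G0 Z $ E2 = Z $ I1E"
  "wZ G0 Z $ F2 = Z $ I1F" "wZ G0 Z $ V a = Z $ I1V a"
  by (simp_all add: wZ_def)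

lemma proj1_wZ [simp]: "proj1 (wZ G0 Z) = Z"
  by (simp add: vec_idx1_eq_iff)

lemma cscale_nth [simp]: "cscale t w $ i = t * w $ i"
  by (simp add: cscale_def)

lemma cvec_nth [simp]: "cvec x $ i = complex_of_real (x $ i)"
  by (simp add: cvec_def)

lemma ImV_nth [simp]: "ImV w $ i = Im (w $ i)"
  by (simp add: ImV_def)

lemma cconj_nth [simp]: "cconj w $ i = cnj (w $ i)"
  by (simp add: cconj_def)

definition ReV :: "complex^'n \<Rightarrow> real^'n" where
  "ReV Z = (\<chi> i. Re (Z $ i))"

lemma ReV_nth [simp]: "ReV w $ i = Re (w $ i)"
  by (simp add: ReV_def)

section \<open>The real form and its complex bilinear extension\<close>

lemma rform_sum: "rform M x y = (\<Sum>i\<in>UNIV. \<Sum>j\<in>UNIV. x $ i * M $ i $ j * y $ j)"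
  by (simp add: rform_def inner_vec_def matrix_vector_mult_def sum_distrib_left mult.assoc)

lemma rform_add_left: "rform M (x + y) z = rform M x z + rform M y z"
  by (simp add: rform_def inner_left_distrib)

lemma rform_add_right: "rform M z (x + y) = rform M z x + rform M z y"
  by (simp add: rform_def matrix_vector_right_distrib inner_right_distrib)

lemma rform_scale_left: "rform M (s *\<^sub>R x) z = s * rform M x z"
  by (simp add: rform_def)

lemma rform_scale_right: "rform M z (s *\<^sub>R x) = s * rform M z x"
  by (simp add: rform_def matrix_vector_mult_scaleR)

lemma rform_minus_left: "rform M (- x) z = - rform M x z"
  by (simp add: rform_def)

lemma rform_minus_right: "rform M z (- x) = - rform M z x"
  using rform_scale_right[of M z "-1" x] by simp

lemma rform_diff_left: "rform M (x - y) z = rform M x z - rform M y z"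
  by (simp add: rform_def inner_diff_left)

lemma rform_diff_right: "rform M z (x - y) = rform M z x - rform M z y"
  using rform_add_right[of M z x "- y"] by (simp add: rform_minus_right)

lemma rform_zero [simp]: "rform M 0 x = 0" "rform M x 0 = 0"
  by (simp_all add: rform_def)

lemmas rform_linear = rform_add_left rform_add_right rform_scale_left rform_scale_right
  rform_minus_left rform_minus_right rform_diff_left rform_diff_right

lemma rform_commute: "transpose M = M \<Longrightarrow> rform M x y = rform M y x"
  unfolding rform_def by (metis dot_lmul_matrix inner_commute transpose_matrix_vector)

lemma cform_ReIm:
  assumes "transpose M = M"
  shows "cform M Z Z = complex_of_real (rform M (ReV Z) (ReV Z) - rform M (ImV Z) (ImV Z))
      + 2 * \<i> * complex_of_real (rform M (ReV Z) (ImV Z))" (is ?A)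
    and "cform M Z (cconj Z) = complex_of_real (rform M (ReV Z) (ReV Z) + rform M (ImV Z) (ImV Z))" (is ?B)
proof -
  have c: "rform M (ImV Z) (ReV Z) = rform M (ReV Z) (ImV Z)"
    by (rule rform_commute[OF assms])
  have "Re (cform M Z Z) = rform M (ReV Z) (ReV Z) - rform M (ImV Z) (ImV Z)"
    "Im (cform M Z Z) = rform M (ReV Z) (ImV Z) + rform M (ImV Z) (ReV Z)"
    "Re (cform M Z (cconj Z)) = rform M (ReV Z) (ReV Z) + rform M (ImV Z) (ImV Z)"
    "Im (cform M Z (cconj Z)) = rform M (ImV Z) (ReV Z) - rform M (ReV Z) (ImV Z)"
    unfolding cform_def rform_sum
    by (simp_all add: Re_sum Im_sum sum.distrib[symmetric] sum_subtractf[symmetric] algebra_simps)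
  then show ?A ?B using c by (auto simp: complex_eq_iff)
qed

lemma cform_cvec_left:
  "cform M (cvec l) Z = complex_of_real (rform M l (ReV Z)) + \<i> * complex_of_real (rform M l (ImV Z))"
proof -
  have "Re (cform M (cvec l) Z) = rform M l (ReV Z)" "Im (cform M (cvec l) Z) = rform M l (ImV Z)"
    unfolding cform_def rform_sum by (simp_all add: Re_sum Im_sum)
  then show ?thesis by (simp add: complex_eq_iff)
qed

lemma gramL_rform:
  "rform (gramL G0) x y = x $ E1 * y $ F1 + x $ F1 * y $ E1 + rform (gramL1 G0) (proj1 x) (proj1 y)"
  unfolding rform_sum by (simp add: sum_idx sum_idx1 gramL_def gramL1_def)

lemma gramL1_rform:
  "rform (gramL1 G0) x y = x $ I1E * y $ I1F + x $ I1F * y $ I1E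
     + rform (map_matrix real_of_int G0) (projV x) (projV y)"
  unfolding rform_sum by (simp add: sum_idx1 gramL1_def)

lemma gramL_cform:
  "cform (gramL G0) x y = x $ E1 * y $ F1 + x $ F1 * y $ E1 + cform (gramL1 G0) (proj1 x) (proj1 y)"
  unfolding cform_def by (simp add: sum_idx sum_idx1 gramL_def gramL1_def)

lemma cform_scale: "cform M (cscale s v) (cscale t w) = s * t * cform M v w"
  by (simp add: cform_def sum_distrib_left mult_ac)

lemma cform_add_left: "cform M (v + v') w = cform M v w + cform M v' w"
  by (simp add: cform_def ring_distribs sum.distrib)

lemma cform_add_right: "cform M w (v + v') = cform M w v + cform M w v'"
  by (simp add: cform_def ring_distribs sum.distrib)

lemma cform_scale_left: "cform M (cscale s v) w = s * cform M v w"
  by (simp add: cform_def sum_distrib_left mult_ac)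

lemma cform_scale_right: "cform M v (cscale s w) = s * cform M v w"
  by (simp add: cform_def sum_distrib_left mult_ac)

lemma cmv_cvec: "cmv g (cvec x) = cvec (g *v x)"
  by (simp add: vec_eq_iff cmv_def matrix_vector_mult_def)

lemma cmv_cconj: "cmv g (cconj w) = cconj (cmv g w)"
  by (simp add: vec_eq_iff cmv_def)

lemma cmv_add: "cmv g (v + w) = cmv g v + cmv g w"
  by (simp add: vec_eq_iff cmv_def ring_distribs sum.distrib)

lemma cmv_scale: "cmv g (cscale t w) = cscale t (cmv g w)"
  by (simp add: vec_eq_iff cmv_def sum_distrib_left mult_ac)

lemma cmv_ReIm: "ReV (cmv g w) = g *v ReV w" "ImV (cmv g w) = g *v ImV w"
  by (simp_all add: vec_eq_iff cmv_def matrix_vector_mult_def Re_sum Im_sum)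

lemma cmv_mult: "cmv (g ** h) w = cmv g (cmv h w)"
proof -
  have "(\<Sum>j\<in>UNIV. \<Sum>k\<in>UNIV. complex_of_real (g $ i $ k) * complex_of_real (h $ k $ j) * w $ j)
      = (\<Sum>k\<in>UNIV. \<Sum>j\<in>UNIV. complex_of_real (g $ i $ k) * complex_of_real (h $ k $ j) * w $ j)" for i
    by (rule sum.swap)
  then show ?thesis
    by (simp add: vec_eq_iff cmv_def matrix_matrix_mult_def sum_distrib_left sum_distrib_right mult.assoc)
qed

lemma ReV_ImV_eqI: "ReV v = ReV w \<Longrightarrow> ImV v = ImV w \<Longrightarrow> v = w"
  by (auto simp: vec_eq_iff complex_eq_iff)

section \<open>Isometries\<close>

definition isometry :: "real^'n^'n \<Rightarrow> real^'n^'n \<Rightarrow> bool" where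
  "isometry M g \<longleftrightarrow> (\<forall>x y. rform M (g *v x) (g *v y) = rform M x y)"

lemma isometry_iff: "isometry M g \<longleftrightarrow> transpose g ** M ** g = M"
proof -
  have "rform M (g *v x) (g *v y) = rform (transpose g ** M ** g) x y" for x y
  proof -
    have adj: "x \<bullet> (transpose g *v z) = (g *v x) \<bullet> z" for z
      unfolding transpose_matrix_vector inner_commute[of x] dot_lmul_matrix by (rule inner_commute)
    show ?thesis
      unfolding rform_def matrix_vector_mul_assoc[symmetric] adj by (rule refl)
  qed
  moreover have "A = B" if "\<And>x y. rform A x y = rform B x y" for A B :: "real^'n^'n"
  proof -
    have "A *v y = B *v y" for y
      using that unfolding rform_def by (metis inner_commute vector_eq_ldot)
    then show ?thesis using matrix_eq by blast
  qed
  ultimately show ?thesis unfolding isometry_def by metis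
qed

lemma isometry_mult: "isometry M g \<Longrightarrow> isometry M h \<Longrightarrow> isometry M (g ** h)"
  by (simp add: isometry_def matrix_vector_mul_assoc[symmetric])

lemma isometry_cform:
  assumes "isometry M g"
  shows "cform M (cmv g v) (cmv g w) = cform M v w"
proof -
  have c: "cform M v w = Complex (rform M (ReV v) (ReV w) - rform M (ImV v) (ImV w))
     (rform M (ReV v) (ImV w) + rform M (ImV v) (ReV w))" for v w
    unfolding cform_def rform_sum
    by (simp add: complex_eq_iff Re_sum Im_sum sum.distrib[symmetric] sum_subtractf[symmetric] algebra_simps)
  show ?thesis unfolding c using assms by (simp add: cmv_ReIm isometry_def)
qed

subsection \<open>The tube domain and the affine cone\<close>

locale even_negdef =
  fixes G0 :: "int^'m^'m::finite"
  assumes sym: "transpose G0 = G0"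
    and even_diag: "\<forall>i. even (G0 $ i $ i)"
    and negdef: "\<forall>x::real^'m. x \<noteq> 0 \<longrightarrow> rform (map_matrix real_of_int G0) x x < 0"
begin

abbreviation "BL \<equiv> gramL G0"
abbreviation "BL1 \<equiv> gramL1 G0"
abbreviation "BV \<equiv> map_matrix real_of_int G0"

lemma G0_commute: "G0 $ a $ b = G0 $ b $ a"
  using sym by (metis (no_types) transpose_def vec_lambda_beta)

lemma transpose_gramL: "transpose BL = BL"
proof -
  have "BL $ j $ i = BL $ i $ j" for i j
    by (cases i; cases j) (simp_all add: gramL_def G0_commute)
  then show ?thesis by (simp add: vec_eq_iff transpose_def)
qed

lemma transpose_gramL1: "transpose BL1 = BL1"
proof -
  have "BL1 $ j $ i = BL1 $ i $ j" for i j
    by (cases i; cases j) (simp_all add: gramL1_def G0_commute)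
  then show ?thesis by (simp add: vec_eq_iff transpose_def)
qed

lemmas rformL_commute = rform_commute[OF transpose_gramL]
lemmas rform1_commute = rform_commute[OF transpose_gramL1]

lemma rformV_nonpos: "rform BV x x \<le> 0"
  using negdef by (cases "x = 0") (auto simp: less_imp_le)

section \<open>Nondegeneracy, and signs in the Lorentzian space of \<open>L1\<close>\<close>

lemma gramL1_nondegenerate:
  assumes "\<And>y. rform BL1 x y = 0"
  shows "x = 0"
proof -
  have "projV (axis I1F 1 :: real^'m idx1) = 0" "projV (axis I1E 1 :: real^'m idx1) = 0"
    by (simp_all add: vec_eq_iff axis_def)
  with assms[of "axis I1F 1"] assms[of "axis I1E 1"] have "x $ I1E = 0" "x $ I1F = 0"
    by (simp_all add: gramL1_rform axis_def)
  with assms[of x] have "rform BV (projV x) (projV x) = 0"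
    by (simp add: gramL1_rform)
  then have "projV x = 0" using negdef by fastforce
  then have "x $ I1V a = 0" for a by (metis projV_nth zero_index)
  then show ?thesis using \<open>x $ I1E = 0\<close> \<open>x $ I1F = 0\<close> by (simp add: vec_idx1_eq_iff)
qed

lemma gramL_nondegenerate:
  assumes "\<And>y. rform BL x y = 0"
  shows "x = 0"
proof -
  have "proj1 (axis F1 1 :: real^'m idx) = 0" "proj1 (axis E1 1 :: real^'m idx) = 0"
    by (simp_all add: vec_idx1_eq_iff axis_def)
  with assms[of "axis F1 1"] assms[of "axis E1 1"] have x: "x $ E1 = 0" "x $ F1 = 0"
    by (simp_all add: gramL_rform axis_def)
  have "proj1 x = 0"
  proof (rule gramL1_nondegenerate)
    show "rform BL1 (proj1 x) y = 0" for y
      using assms[of "emb1 y"] x by (simp add: gramL_rform)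
  qed
  then have "proj1 x $ I1E = 0" "proj1 x $ I1F = 0" "proj1 x $ I1V a = 0" for a by simp_all
  then show ?thesis using x by (simp add: vec_idx_eq_iff)
qed

text \<open>The coordinate \<open>I1F\<close> is the pairing with \<open>e2\<close>. On its kernel
  the hyperbolic part of the form vanishes and only the definite part is left, so the radical there
  is the line of \<open>e2\<close>. This replaces every appeal to the signature of
  \<open>L1\<close>.\<close>

lemma rform1_nonpos:
  assumes "z $ I1F = 0"
  shows "rform BL1 z z \<le> 0" and "rform BL1 z z = 0 \<Longrightarrow> projV z = 0"
proof -
  have eq: "rform BL1 z z = rform BV (projV z) (projV z)"
    using assms by (simp add: gramL1_rform)
  then show "rform BL1 z z \<le> 0" using rformV_nonpos by simp
  show "rform BL1 z z = 0 \<Longrightarrow> projV z = 0"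
    using eq negdef by fastforce
qed

lemma E_pos:
  assumes "rform BL1 Y Y > 0" "Y $ I1F > 0"
  shows "Y $ I1E > 0"
proof -
  have "2 * (Y $ I1E * Y $ I1F) > 0"
    using assms(1) rformV_nonpos[of "projV Y"] by (simp add: gramL1_rform)
  then show ?thesis using assms(2) by (simp add: zero_less_mult_iff)
qed

text \<open>The vector \<open>z = Y_F c - c_F Y\<close> is orthogonal to \<open>e2\<close>, whence \<open>(z, z) \<le> 0\<close>.\<close>

lemma cone_pairing_pos:
  assumes Y: "rform BL1 Y Y > 0" "Y $ I1F > 0"
    and c: "c $ I1E \<ge> 0" "c $ I1F \<ge> 0" "c \<noteq> 0" "rform BL1 c c \<ge> 0"
  shows "rform BL1 Y c > 0"
proof (cases "c $ I1F = 0")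
  case True
  then have V: "projV c = 0" using rform1_nonpos[of c] c(4) by linarith
  then have "c $ I1V a = 0" for a by (metis projV_nth zero_index)
  with c True have "c $ I1E > 0" by (auto simp: vec_idx1_eq_iff order.strict_iff_order)
  then show ?thesis using Y True V by (simp add: gramL1_rform)
next
  case False
  define z where "z = (Y $ I1F) *\<^sub>R c - (c $ I1F) *\<^sub>R Y"
  have "rform BL1 z z \<le> 0" by (rule rform1_nonpos) (simp add: z_def)
  then have "(Y $ I1F)\<^sup>2 * rform BL1 c c + (c $ I1F)\<^sup>2 * rform BL1 Y Y \<le> 2 * (Y $ I1F * c $ I1F) * rform BL1 Y c"
    by (simp add: z_def rform_linear rform1_commute[of c Y] algebra_simps power2_eq_square)
  moreover have "(Y $ I1F)\<^sup>2 * rform BL1 c c \<ge> 0" "(c $ I1F)\<^sup>2 * rform BL1 Y Y > 0"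
    using c Y False by simp_all
  ultimately have "0 < 2 * (Y $ I1F * c $ I1F) * rform BL1 Y c" by linarith
  moreover have "Y $ I1F * c $ I1F > 0" using Y c False by simp
  ultimately show ?thesis by (simp add: zero_less_mult_iff)
qed

text \<open>Leaves only two candidates for the cone containing a transported cusp direction; a
  pairing with an interior point then decides.\<close>

lemma isotropic_cone_sign:
  assumes "rform BL1 c c = 0"
  shows "(c $ I1E \<ge> 0 \<and> c $ I1F \<ge> 0) \<or> (c $ I1E \<le> 0 \<and> c $ I1F \<le> 0)"
proof -
  have "c $ I1E * c $ I1F \<ge> 0"
    using assms rformV_nonpos[of "projV c"] by (simp add: gramL1_rform)
  then show ?thesis by (simp add: zero_le_mult_iff)
qed

text \<open>One of the two halves of the open cone, selected by the sign of the pairing with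
  \<open>e2\<close>. It is the explicit form of \<open>posC\<close>, which is defined through a
  connected component.\<close>

definition poscone :: "(real^'m idx1) set" where
  "poscone = {Y. rform BL1 Y Y > 0 \<and> Y $ I1F > 0}"

text \<open>The mixed term in the norm of a convex combination is a pairing of two vectors of the
  cone, hence positive by \<open>cone_pairing_pos\<close>. Convexity later supplies the
  connectedness of the tube.\<close>

lemma convex_poscone: "convex poscone"
  unfolding convex_alt
proof (intro ballI allI impI)
  fix x y :: "real^'m idx1" and u :: real
  assume xy: "x \<in> poscone" "y \<in> poscone" and "0 \<le> u \<and> u \<le> 1"
  then have u: "0 \<le> u" "u \<le> 1" by auto
  have y: "rform BL1 y y > 0" "y $ I1F > 0" and x: "rform BL1 x x > 0" "x $ I1F > 0"
    using xy by (simp_all add: poscone_def)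
  then have "y \<noteq> 0" by (metis less_irrefl zero_index)
  then have "rform BL1 x y > 0"
    using E_pos[OF y] y x by - (rule cone_pairing_pos, simp_all)
  then have p: "(1 - u) * (1 - u) * rform BL1 x x + 2 * (u * (1 - u)) * rform BL1 x y \<ge> 0"
    using xy u unfolding poscone_def by simp
  have q: "(1 - u) * x $ I1F \<ge> 0" using xy u unfolding poscone_def by simp
  have r: "u * u * rform BL1 y y > 0" "u * y $ I1F > 0" if "u \<noteq> 0"
    using xy u that unfolding poscone_def by simp_all
  have "u * u * rform BL1 y y + (1 - u) * (1 - u) * rform BL1 x x + 2 * (u * (1 - u)) * rform BL1 x y > 0
      \<and> (1 - u) * x $ I1F + u * y $ I1F > 0"
  proof (cases "u = 0")
    case True
    then show ?thesis using xy(1) by (simp add: poscone_def)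
  next
    case False
    then show ?thesis using p q r by (intro conjI) linarith+
  qed
  then show "(1 - u) *\<^sub>R x + u *\<^sub>R y \<in> poscone"
    unfolding poscone_def
    by (simp add: rform_linear rform1_commute[of y x] algebra_simps)
qed

section \<open>The tube domain as an affine slice of the cone\<close>

lemma wZ_in_cone0_iff: "wZ G0 Z \<in> cone0 G0 \<longleftrightarrow> rform BL1 (ImV Z) (ImV Z) > 0"
  and cform_wZ_conj: "cform BL (wZ G0 Z) (cconj (wZ G0 Z)) = complex_of_real (2 * rform BL1 (ImV Z) (ImV Z))"
proof -
  have p: "proj1 (cconj (wZ G0 Z)) = cconj Z" by (simp add: vec_idx1_eq_iff)
  have q: "cform BL (wZ G0 Z) (wZ G0 Z) = 0" by (simp add: gramL_cform)
  show r: "cform BL (wZ G0 Z) (cconj (wZ G0 Z)) = complex_of_real (2 * rform BL1 (ImV Z) (ImV Z))"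
    by (simp add: gramL_cform p cform_ReIm[OF transpose_gramL1] field_simps complex_eq_iff)
  show "wZ G0 Z \<in> cone0 G0 \<longleftrightarrow> rform BL1 (ImV Z) (ImV Z) > 0"
    unfolding cone0_def by (simp add: q r)
qed

text \<open>Real and imaginary part of a point of \<open>cone0\<close> span a positive definite
  plane. If the \<open>F1\<close>-coordinate vanished, this plane would project isometrically to
  \<open>L1\<close>, where it would meet the orthogonal complement of \<open>e2\<close> in a vector
  of positive norm; \<open>z\<close> is such a vector.\<close>

lemma cone0_F1_nonzero:
  assumes "w \<in> cone0 G0"
  shows "w $ F1 \<noteq> 0"
proof
  assume F: "w $ F1 = 0"
  define Z where "Z = proj1 w"
  have p: "proj1 (cconj w) = cconj Z" by (simp add: vec_idx1_eq_iff Z_def)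
  have "cform BL1 Z Z = 0" "Re (cform BL1 Z (cconj Z)) > 0"
    using assms F unfolding cone0_def by (simp_all add: gramL_cform p Z_def[symmetric])
  then have q: "rform BL1 (ReV Z) (ReV Z) = rform BL1 (ImV Z) (ImV Z)" "rform BL1 (ReV Z) (ImV Z) = 0"
    "rform BL1 (ReV Z) (ReV Z) > 0"
    by (simp_all add: cform_ReIm[OF transpose_gramL1] complex_eq_iff)
  define x y where "x = ReV Z" and "y = ImV Z"
  define z where "z = (x $ I1F) *\<^sub>R y - (y $ I1F) *\<^sub>R x"
  have "rform BL1 z z \<le> 0" by (rule rform1_nonpos) (simp add: z_def)
  then have "((x $ I1F)\<^sup>2 + (y $ I1F)\<^sup>2) * rform BL1 x x \<le> 0"
    using q by (simp add: z_def x_def y_def rform_linear rform1_commute[of "ImV Z" "ReV Z"] algebra_simps power2_eq_square)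
  then have "(x $ I1F)\<^sup>2 + (y $ I1F)\<^sup>2 \<le> 0"
    using q(3) by (simp add: x_def mult_le_0_iff)
  then have "x $ I1F = 0" by (simp add: sum_power2_le_zero_iff)
  then show False using rform1_nonpos(1)[of x] q(3) by (simp add: x_def)
qed

lemma cone0_scale:
  assumes "w \<in> cone0 G0" "t \<noteq> 0"
  shows "cscale t w \<in> cone0 G0"
proof -
  have c: "cconj (cscale t w) = cscale (cnj t) (cconj w)" by (simp add: vec_eq_iff)
  have t: "t * cnj t = complex_of_real ((cmod t)\<^sup>2)" by (rule complex_norm_square[symmetric])
  show ?thesis using assms unfolding cone0_def
    by (simp add: cform_scale c t del: of_real_power)
qed

lemma cone0_eq_wZ:
  assumes "w \<in> cone0 G0"
  shows "w = cscale (w $ F1) (wZ G0 (cscale (1 / w $ F1) (proj1 w)))"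
proof -
  define l where "l = w $ F1"
  have l: "l \<noteq> 0" using cone0_F1_nonzero[OF assms] by (simp add: l_def)
  have "2 * (w $ E1 * l) + cform BL1 (proj1 w) (proj1 w) = 0"
    using assms unfolding cone0_def l_def by (simp add: gramL_cform)
  then have "cform BL1 (proj1 w) (proj1 w) = - (2 * (w $ E1 * l))"
    using add_eq_0_iff by fastforce
  then show ?thesis using l unfolding l_def[symmetric]
    by (simp add: vec_idx_eq_iff cform_scale field_simps) (simp add: l_def)
qed

lemma cone0_wZ:
  assumes "w \<in> cone0 G0"
  shows "wZ G0 (cscale (1 / w $ F1) (proj1 w)) = cscale (1 / w $ F1) w"
proof -
  define l W where "l = w $ F1" and "W = wZ G0 (cscale (1 / w $ F1) (proj1 w))"
  have "w $ i = l * W $ i" for i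
    using arg_cong[OF cone0_eq_wZ[OF assms], of "\<lambda>v. v $ i"] by (simp only: l_def W_def cscale_nth)
  moreover have "l \<noteq> 0" using cone0_F1_nonzero[OF assms] by (simp add: l_def)
  ultimately have "W = cscale (1 / l) w" by (simp add: vec_eq_iff)
  then show ?thesis by (simp only: l_def W_def)
qed

lemma continuous_wZ: "continuous_on S (wZ G0)"
  unfolding wZ_def
proof (rule continuous_on_vec_lambda)
  fix i :: "'m idx"
  show "continuous_on S (\<lambda>Z. case i of
      E1 \<Rightarrow> - cform BL1 Z Z / 2 | F1 \<Rightarrow> 1
    | E2 \<Rightarrow> Z $ I1E | F2 \<Rightarrow> Z $ I1F | V a \<Rightarrow> Z $ I1V a)"
    by (cases i) (simp_all add: cform_def continuous_on_component continuous_on_id continuous_on_sum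
      continuous_on_mult continuous_on_const continuous_on_minus continuous_on_divide)
qed


lemma ImV_Z0: "ImV (Z0 :: complex^'m idx1) \<in> poscone"
proof -
  have "projV (ImV (Z0 :: complex^'m idx1)) = 0" by (simp add: vec_eq_iff Z0_def)
  then show ?thesis by (simp add: poscone_def gramL1_rform Z0_def)
qed

lemma wZ_Z0_cone0: "wZ G0 Z0 \<in> cone0 G0"
  using ImV_Z0 by (simp add: wZ_in_cone0_iff poscone_def)

lemma coneP_subset: "coneP G0 \<subseteq> cone0 G0"
  unfolding coneP_def by (rule connected_component_subset)

lemma coneP_connected: "connected (coneP G0)"
  unfolding coneP_def by simp

text \<open>The way membership in the chosen component is proved: join the point to a known one by a
  connected family inside \<open>cone0\<close>.\<close>

lemma coneP_absorbs:
  assumes "connected S" "S \<subseteq> cone0 G0" "w \<in> S" "w \<in> coneP G0"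
  shows "S \<subseteq> coneP G0"
proof -
  have "connected_component_set (cone0 G0) w = coneP G0"
    using assms(4) unfolding coneP_def by (metis connected_component_eq)
  then show ?thesis using connected_component_maximal[OF assms(3,1,2)] by simp
qed

text \<open>The points with imaginary part in \<open>poscone\<close> form a convex set containing
  \<open>Z0\<close>, so their images lie in one component. Conversely, a continuous function without
  zeros keeps its sign on the connected set \<open>coneP\<close>.\<close>

lemma tube_iff: "Z \<in> tube G0 \<longleftrightarrow> ImV Z \<in> poscone"
proof
  assume "ImV Z \<in> poscone"
  define T where "T = {Z :: complex^'m idx1. ImV Z \<in> poscone}"
  have "convex T"
    unfolding convex_alt
  proof (intro ballI allI impI)
    fix x y :: "complex^'m idx1" and u :: real
    assume "x \<in> T" "y \<in> T" "0 \<le> u \<and> u \<le> 1"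
    moreover have "ImV ((1 - u) *\<^sub>R x + u *\<^sub>R y) = (1 - u) *\<^sub>R ImV x + u *\<^sub>R ImV y"
      by (simp add: vec_eq_iff)
    ultimately show "(1 - u) *\<^sub>R x + u *\<^sub>R y \<in> T"
      using convex_poscone unfolding T_def convex_alt by simp
  qed
  then have "connected (wZ G0 ` T)"
    by (intro connected_continuous_image continuous_wZ convex_connected)
  moreover have "wZ G0 ` T \<subseteq> cone0 G0"
    by (auto simp: T_def wZ_in_cone0_iff poscone_def)
  moreover have "wZ G0 Z0 \<in> wZ G0 ` T" using ImV_Z0 by (simp add: T_def)
  ultimately have "wZ G0 ` T \<subseteq> coneP G0"
    unfolding coneP_def by (intro connected_component_maximal)
  then show "Z \<in> tube G0"
    using \<open>ImV Z \<in> poscone\<close> by (auto simp: tube_def poscone_def T_def)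
next
  assume Z: "Z \<in> tube G0"
  \<comment> \<open>The \<open>I1F\<close>-coordinate of the imaginary part, written so that it is
    invariant under scaling and hence makes sense on the whole cone. A zero would give a vector of
    positive norm orthogonal to \<open>e2\<close>.\<close>
  define \<phi> where "\<phi> w = Im (w $ F2 / w $ F1)" for w :: "complex^'m idx"
  have nz: "\<phi> w \<noteq> 0" if "w \<in> cone0 G0" for w
  proof
    assume 0: "\<phi> w = 0"
    define Z' where "Z' = cscale (1 / w $ F1) (proj1 w)"
    have "cscale (1 / w $ F1) w \<in> cone0 G0"
      using that cone0_F1_nonzero by (intro cone0_scale) simp_all
    then have "wZ G0 Z' \<in> cone0 G0" using cone0_wZ[OF that] by (simp add: Z'_def)
    then have "rform BL1 (ImV Z') (ImV Z') > 0" by (simp add: wZ_in_cone0_iff)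
    moreover have "ImV Z' $ I1F = 0" using 0 by (simp add: Z'_def \<phi>_def)
    ultimately show False using rform1_nonpos(1)[of "ImV Z'"] by simp
  qed
  have "continuous_on (coneP G0) \<phi>"
    unfolding \<phi>_def using cone0_F1_nonzero coneP_subset
    by (intro continuous_intros continuous_on_component) auto
  then have "connected (\<phi> ` coneP G0)"
    using coneP_connected by (rule connected_continuous_image)
  moreover have "\<phi> (wZ G0 Z0) \<in> \<phi> ` coneP G0"
    using wZ_Z0_cone0 by (intro imageI) (simp add: coneP_def connected_component_refl)
  moreover have "\<phi> (wZ G0 Z0) = 1" by (simp add: \<phi>_def Z0_def)
  moreover have "\<phi> (wZ G0 Z) \<in> \<phi> ` coneP G0" using Z by (simp add: tube_def)
  moreover have "0 \<notin> \<phi> ` coneP G0" using nz coneP_subset by force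
  ultimately have "\<phi> (wZ G0 Z) > 0"
    unfolding is_interval_connected_1[symmetric] is_interval_1 by (metis linorder_not_le zero_le_one)
  then show "ImV Z \<in> poscone"
    using Z by (simp add: \<phi>_def tube_def poscone_def)
qed

lemma posC_eq: "posC G0 = poscone"
proof -
  have "Y = ImV (\<chi> i. \<i> * complex_of_real (Y $ i))" for Y :: "real^'m idx1"
    by (simp add: vec_eq_iff)
  then show ?thesis unfolding posC_def by (force simp: tube_iff)
qed

text \<open>The nonzero complex numbers are connected, so no scalar, not even -1, leads to the other
  component.\<close>

lemma coneP_scale:
  assumes "w \<in> coneP G0" "t \<noteq> 0"
  shows "cscale t w \<in> coneP G0"
proof -
  define S where "S = (\<lambda>t. cscale t w) ` (- {0})"
  have "connected (- {0 :: complex})" by (rule connected_punctured_universe) simp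
  moreover have "continuous_on (- {0}) (\<lambda>t. cscale t w)"
    unfolding cscale_def by (intro continuous_on_vec_lambda continuous_intros)
  ultimately have "connected S"
    unfolding S_def by (intro connected_continuous_image)
  moreover have "S \<subseteq> cone0 G0"
    using assms(1) coneP_subset cone0_scale by (auto simp: S_def)
  moreover have "w \<in> S"
  proof -
    have "w = cscale 1 w" by (simp add: vec_eq_iff)
    then show ?thesis unfolding S_def by (rule image_eqI) simp
  qed
  ultimately have "S \<subseteq> coneP G0" using assms(1) by (intro coneP_absorbs)
  then show ?thesis using assms(2) by (auto simp: S_def)
qed

lemma coneP_wZ:
  assumes "w \<in> coneP G0"
  shows "w $ F1 \<noteq> 0" and "cscale (1 / w $ F1) (proj1 w) \<in> tube G0"
    and "w = cscale (w $ F1) (wZ G0 (cscale (1 / w $ F1) (proj1 w)))"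
proof -
  have w: "w \<in> cone0 G0" using assms coneP_subset by auto
  show F: "w $ F1 \<noteq> 0" by (rule cone0_F1_nonzero[OF w])
  show "w = cscale (w $ F1) (wZ G0 (cscale (1 / w $ F1) (proj1 w)))" by (rule cone0_eq_wZ[OF w])
  have "wZ G0 (cscale (1 / w $ F1) (proj1 w)) \<in> coneP G0"
    unfolding cone0_wZ[OF w] using F assms by (intro coneP_scale) simp_all
  then show "cscale (1 / w $ F1) (proj1 w) \<in> tube G0"
    using coneP_subset by (auto simp: tube_def wZ_in_cone0_iff[symmetric])
qed

lemma isometry_cone0:
  assumes "isometry BL g" "w \<in> cone0 G0"
  shows "cmv g w \<in> cone0 G0"
  using assms(2) unfolding cone0_def
  by (simp add: cmv_cconj[symmetric] isometry_cform[OF assms(1)])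

end

subsection \<open>Eichler transvections\<close>

text \<open>The Eichler transvection, usually written \<open>E(u, a)\<close>. It is a unipotent
  isometry when \<open>u\<close> is isotropic and \<open>a\<close> is orthogonal to
  \<open>u\<close>; the matrix form matches the definition of \<open>Otilde_plus\<close>.\<close>

definition transvection :: "real^'n^'n \<Rightarrow> real^'n \<Rightarrow> real^'n \<Rightarrow> real^'n^'n" where
  "transvection M u a = (\<chi> i j. (if i = j then 1 else 0) - u $ i * (M *v a) $ j
     + a $ i * (M *v u) $ j - rform M a a / 2 * u $ i * (M *v u) $ j)"

lemma transvection_apply:
  assumes "transpose M = M"
  shows "transvection M u a *v x
    = x - rform M a x *\<^sub>R u + rform M u x *\<^sub>R a - (rform M a a / 2 * rform M u x) *\<^sub>R u"
proof -
  have r: "(\<Sum>j\<in>UNIV. (M *v b) $ j * x $ j) = rform M b x" for b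
    using rform_commute[OF assms, of x b] by (simp add: rform_def inner_vec_def mult.commute)
  have "(\<Sum>j\<in>UNIV. transvection M u a $ i $ j * x $ j) = x $ i - rform M a x * u $ i
      + rform M u x * a $ i - rform M a a / 2 * rform M u x * u $ i" for i
  proof -
    have "transvection M u a $ i $ j * x $ j = (if i = j then x $ j else 0) - u $ i * ((M *v a) $ j * x $ j)
        + a $ i * ((M *v u) $ j * x $ j) - rform M a a / 2 * u $ i * ((M *v u) $ j * x $ j)" for j
      by (simp add: transvection_def algebra_simps)
    then show ?thesis
      by (simp only: sum.distrib sum_subtractf sum_distrib_left[symmetric] r) (simp add: mult_ac)
  qed
  then show ?thesis
    by (simp add: vec_eq_iff matrix_vector_mult_def)
qed

lemma transvection_0: "transvection M u 0 = mat 1"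
  by (simp add: vec_eq_iff transvection_def mat_def)

lemma transvection_inverse:
  assumes "transpose M = M" "rform M u u = 0" "rform M u a = 0"
  shows "transvection M u (- a) *v (transvection M u a *v x) = x"
  using assms(2,3) rform_commute[OF assms(1), of a u]
  by (simp add: transvection_apply[OF assms(1)] rform_linear vec_eq_iff field_simps)

lemma isometry_transvection:
  assumes "transpose M = M" "rform M u u = 0" "rform M u a = 0"
  shows "isometry M (transvection M u a)"
  unfolding isometry_def
proof (intro allI)
  fix x y
  have c: "rform M a u = 0" "rform M x u = rform M u x" "rform M x a = rform M a x"
    using assms(3) rform_commute[OF assms(1)] by simp_all
  define \<beta> \<beta>' where "\<beta> = rform M u x" and "\<beta>' = rform M u y"
  define \<alpha> \<alpha>' where "\<alpha> = rform M a x" and "\<alpha>' = rform M a y"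
  define q where "q = rform M a a"
  have x: "transvection M u a *v x = x - (\<alpha> + q / 2 * \<beta>) *\<^sub>R u + \<beta> *\<^sub>R a"
    and y: "transvection M u a *v y = y - (\<alpha>' + q / 2 * \<beta>') *\<^sub>R u + \<beta>' *\<^sub>R a"
    by (simp_all add: transvection_apply[OF assms(1)] \<beta>_def \<beta>'_def \<alpha>_def \<alpha>'_def q_def algebra_simps)
  show "rform M (transvection M u a *v x) (transvection M u a *v y) = rform M x y"
    unfolding x y rform_linear assms(2,3) c
    unfolding \<beta>_def[symmetric] \<beta>'_def[symmetric] \<alpha>_def[symmetric] \<alpha>'_def[symmetric] q_def[symmetric]
    by (simp add: field_simps)
qed

context even_negdef begin

text \<open>Scaling \<open>a\<close> by a real parameter \<open>s\<close> joins the transvection to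
  the identity through isometries, and the matrix entries are quadratic polynomials in
  \<open>s\<close>. The orbit of \<open>w\<close> is therefore connected and stays in its
  component.\<close>

lemma transvection_coneP:
  assumes "rform BL u u = 0" "rform BL u a = 0" "w \<in> coneP G0"
  shows "cmv (transvection BL u a) w \<in> coneP G0"
proof -
  define S where "S = (\<lambda>s. cmv (transvection BL u (s *\<^sub>R a)) w) ` UNIV"
  define A :: "'m idx \<Rightarrow> 'm idx \<Rightarrow> real" where "A i j = (if i = j then 1 else 0)" for i j
  define B where "B i j = a $ i * (BL *v u) $ j - u $ i * (BL *v a) $ j" for i j
  define C where "C i j = rform BL a a / 2 * u $ i * (BL *v u) $ j" for i j
  have entry: "transvection BL u (s *\<^sub>R a) $ i $ j = A i j + s * B i j - s * s * C i j" for s i j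
    by (simp add: transvection_def A_def B_def C_def rform_linear matrix_vector_mult_scaleR algebra_simps)
  have "continuous_on UNIV (\<lambda>s. cmv (transvection BL u (s *\<^sub>R a)) w)"
    unfolding cmv_def entry by (intro continuous_on_vec_lambda continuous_intros)
  then have "connected S"
    unfolding S_def by (rule connected_continuous_image) (rule connected_UNIV)
  moreover have "S \<subseteq> cone0 G0"
    unfolding S_def using assms coneP_subset
    by (auto intro!: isometry_cone0 isometry_transvection transpose_gramL simp: rform_linear)
  moreover have "w \<in> S"
  proof -
    have "w = cmv (transvection BL u (0 *\<^sub>R a)) w"
      by (simp add: transvection_0 cmv_def mat_def vec_eq_iff if_distrib[of "\<lambda>c. complex_of_real c * _"]
          if_distrib[of "\<lambda>c. c * _"] cong: if_cong)
    then show ?thesis unfolding S_def by (rule image_eqI) simp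
  qed
  ultimately have "S \<subseteq> coneP G0" using assms(3) by (intro coneP_absorbs)
  then have "cmv (transvection BL u (1 *\<^sub>R a)) w \<in> coneP G0" unfolding S_def by blast
  then show ?thesis by simp
qed

end

subsection \<open>The discriminant kernel and the Eichler criterion\<close>

lemma latt_closed:
  "0 \<in> latt" "x \<in> latt \<Longrightarrow> y \<in> latt \<Longrightarrow> x + y \<in> latt" "x \<in> latt \<Longrightarrow> y \<in> latt \<Longrightarrow> x - y \<in> latt"
  "x \<in> latt \<Longrightarrow> - x \<in> latt" "r \<in> \<int> \<Longrightarrow> x \<in> latt \<Longrightarrow> r *\<^sub>R x \<in> latt" "axis i 1 \<in> latt"
  by (auto simp: latt_def axis_def)

lemma rform_latt_Ints:
  assumes "\<And>i j. M $ i $ j \<in> \<int>" "x \<in> latt" "y \<in> latt"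
  shows "rform M x y \<in> \<int>"
  using assms unfolding rform_sum latt_def by (auto intro!: Ints_sum Ints_mult)

text \<open>Off-diagonal terms occur in equal pairs, so only the diagonal affects the
  parity.\<close>

lemma even_quadratic_form:
  fixes G :: "'a \<Rightarrow> 'a \<Rightarrow> int"
  assumes "finite A" "\<And>i j. G i j = G j i" "\<And>i. even (G i i)"
  shows "even (\<Sum>i\<in>A. \<Sum>j\<in>A. n i * G i j * n j)"
  using assms(1)
proof (induction A)
  case (insert c A)
  have "(\<Sum>i\<in>A. n i * G i c * n c) = (\<Sum>j\<in>A. n c * G c j * n j)"
    by (rule sum.cong) (simp_all add: assms(2)[of _ c])
  then have "(\<Sum>i\<in>insert c A. \<Sum>j\<in>insert c A. n i * G i j * n j)
      = n c * G c c * n c + 2 * (\<Sum>j\<in>A. n c * G c j * n j) + (\<Sum>i\<in>A. \<Sum>j\<in>A. n i * G i j * n j)"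
    using insert.hyps by (simp add: sum.distrib)
  then show ?case using insert.IH assms(3) by simp
qed simp

context even_negdef begin

lemma gramL_Ints: "BL $ i $ j \<in> \<int>"
  by (cases i; cases j) (simp_all add: gramL_def)

lemma gramL1_Ints: "BL1 $ i $ j \<in> \<int>"
  by (cases i; cases j) (simp_all add: gramL1_def)

lemma latt_subset_dual: "latt \<subseteq> dual BL"
  using rform_latt_Ints[OF gramL_Ints] by (auto simp: dual_def)

lemma rformV_even:
  assumes "x \<in> latt"
  shows "\<exists>m::int. rform BV x x = 2 * of_int m"
proof -
  define n where "n i = \<lfloor>x $ i\<rfloor>" for i
  have n: "x $ i = of_int (n i)" for i
    using assms by (simp add: latt_def n_def)
  have "even (\<Sum>i\<in>UNIV. \<Sum>j\<in>UNIV. n i * G0 $ i $ j * n j)"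
    by (rule even_quadratic_form) (use even_diag G0_commute in auto)
  then obtain m where "(\<Sum>i\<in>UNIV. \<Sum>j\<in>UNIV. n i * G0 $ i $ j * n j) = 2 * m" by blast
  moreover have "rform BV x x = of_int (\<Sum>i\<in>UNIV. \<Sum>j\<in>UNIV. n i * G0 $ i $ j * n j)"
    by (simp add: rform_sum n)
  ultimately show ?thesis by auto
qed

lemma rform1_even:
  assumes "x \<in> latt"
  shows "\<exists>m::int. rform BL1 x x = 2 * of_int m"
proof -
  obtain e f :: int where ef: "x $ I1E = of_int e" "x $ I1F = of_int f"
    using assms by (auto simp: latt_def elim!: Ints_cases) (meson Ints_cases)
  obtain m :: int where "rform BV (projV x) (projV x) = 2 * of_int m"
    using rformV_even[of "projV x"] assms by (auto simp: latt_def)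
  then have "rform BL1 x x = 2 * of_int (e * f + m)"
    by (simp add: gramL1_rform ef)
  then show ?thesis by blast
qed

lemma rformL_even:
  assumes "x \<in> latt"
  shows "\<exists>m::int. rform BL x x = 2 * of_int m"
proof -
  obtain e f :: int where ef: "x $ E1 = of_int e" "x $ F1 = of_int f"
    using assms by (auto simp: latt_def elim!: Ints_cases) (meson Ints_cases)
  have "proj1 x $ i \<in> \<int>" for i using assms by (cases i) (simp_all add: latt_def)
  then obtain m :: int where "rform BL1 (proj1 x) (proj1 x) = 2 * of_int m"
    using rform1_even[of "proj1 x"] by (auto simp: latt_def)
  then have "rform BL x x = 2 * of_int (e * f + m)"
    by (simp add: gramL_rform ef)
  then show ?thesis by blast
qed

text \<open>Evenness makes \<open>(a, a) / 2\<close> an integer, which gives integral entries. A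
  dual vector pairs integrally with \<open>u\<close> and \<open>a\<close>, so it moves by an
  integral combination of the two; this is triviality on the discriminant group.\<close>

lemma transvection_Otilde_plus:
  assumes u: "u \<in> latt" "rform BL u u = 0" and a: "a \<in> latt" "rform BL u a = 0"
  shows "transvection BL u a \<in> Otilde_plus G0"
proof -
  obtain m :: int where m: "rform BL a a = 2 * of_int m" using rformL_even[OF a(1)] by blast
  have Mv: "(BL *v b) $ j \<in> \<int>" if "b \<in> latt" for b j
    using that gramL_Ints by (auto simp: matrix_vector_mult_def latt_def intro!: Ints_sum Ints_mult)
  have entries: "transvection BL u b $ i $ j \<in> \<int>" if "b = a \<or> b = - a" for b i j
  proof -
    have "b \<in> latt" "rform BL b b / 2 = of_int m"
      using that a m by (auto simp: rform_linear latt_closed)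
    moreover have "c $ k \<in> \<int>" if "c \<in> latt" for c :: "real^'m idx" and k using that by (simp add: latt_def)
    ultimately show ?thesis
      unfolding transvection_def using Mv u by (auto intro!: Ints_add Ints_diff Ints_mult)
  qed
  have l: "transvection BL u b *v x \<in> latt" if "b = a \<or> b = - a" "x \<in> latt" for b x
    using entries[OF that(1)] that(2)
    by (auto simp: latt_def matrix_vector_mult_def intro!: Ints_sum Ints_mult)
  have inv: "transvection BL u (- a) *v (transvection BL u a *v x) = x"
    "transvection BL u a *v (transvection BL u (- a) *v x) = x" for x
    using transvection_inverse[OF transpose_gramL u(2), of a] transvection_inverse[OF transpose_gramL u(2), of "- a"] a
    by (simp_all add: rform_linear)
  have cinv: "cmv (transvection BL u a) (cmv (transvection BL u (- a)) w) = w" for w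
    by (rule ReV_ImV_eqI) (simp_all add: cmv_ReIm inv)
  have "(\<lambda>v. transvection BL u a *v v) ` latt = latt"
  proof
    show "(\<lambda>v. transvection BL u a *v v) ` latt \<subseteq> latt" using l by auto
    show "latt \<subseteq> (\<lambda>v. transvection BL u a *v v) ` latt"
    proof
      fix x :: "real^'m idx" assume "x \<in> latt"
      then show "x \<in> (\<lambda>v. transvection BL u a *v v) ` latt"
        using l[of "- a" x] inv(2)[of x] by (intro image_eqI[of _ _ "transvection BL u (- a) *v x"]) simp_all
    qed
  qed
  moreover have "cmv (transvection BL u a) ` coneP G0 = coneP G0"
  proof
    show "cmv (transvection BL u a) ` coneP G0 \<subseteq> coneP G0"
      using transvection_coneP[OF u(2) a(2)] by auto
    show "coneP G0 \<subseteq> cmv (transvection BL u a) ` coneP G0"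
    proof
      fix w assume "w \<in> coneP G0"
      then show "w \<in> cmv (transvection BL u a) ` coneP G0"
        using transvection_coneP[OF u(2), of "- a"] a cinv[of w]
        by (intro image_eqI[of _ _ "cmv (transvection BL u (- a)) w"]) (simp_all add: rform_linear)
    qed
  qed
  moreover have "transvection BL u a *v x - x \<in> latt" if "x \<in> dual BL" for x
  proof -
    have "rform BL a x \<in> \<int>" "rform BL u x \<in> \<int>"
      using that u a rformL_commute[of x] by (auto simp: dual_def)
    moreover have "transvection BL u a *v x - x = rform BL u x *\<^sub>R a - rform BL a x *\<^sub>R u
        - (of_int m * rform BL u x) *\<^sub>R u"
      by (simp add: transvection_apply[OF transpose_gramL] m)
    ultimately show ?thesis using u a by (simp add: latt_closed)
  qed
  moreover have "transpose (transvection BL u a) ** BL ** transvection BL u a = BL"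
    using isometry_transvection[OF transpose_gramL u(2) a(2)] by (simp add: isometry_iff)
  ultimately show ?thesis using entries[of a] by (simp add: Otilde_plus_def)
qed

lemma Otilde_plus_isometry: "g \<in> Otilde_plus G0 \<Longrightarrow> isometry BL g"
  by (simp add: Otilde_plus_def isometry_iff)

lemma Otilde_plus_latt: "g \<in> Otilde_plus G0 \<Longrightarrow> x \<in> latt \<Longrightarrow> g *v x \<in> latt"
  unfolding Otilde_plus_def by blast

lemma Otilde_plus_mult:
  assumes g: "g \<in> Otilde_plus G0" and h: "h \<in> Otilde_plus G0"
  shows "g ** h \<in> Otilde_plus G0"
proof -
  have "(g ** h) $ i $ j \<in> \<int>" for i j
    using g h by (auto simp: Otilde_plus_def matrix_matrix_mult_def intro!: Ints_sum Ints_mult)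
  moreover have "transpose (g ** h) ** BL ** (g ** h) = BL"
    using isometry_mult[OF Otilde_plus_isometry[OF g] Otilde_plus_isometry[OF h]] by (simp add: isometry_iff)
  moreover have "(\<lambda>v. (g ** h) *v v) ` latt = (\<lambda>v. g *v v) ` (\<lambda>v. h *v v) ` latt"
    by (simp add: image_image matrix_vector_mul_assoc)
  moreover have "cmv (g ** h) ` coneP G0 = cmv g ` cmv h ` coneP G0"
    by (simp add: image_image cmv_mult)
  moreover have "(g ** h) *v x - x \<in> latt" if "x \<in> dual BL" for x
  proof -
    have "(g ** h) *v x - x = g *v (h *v x - x) + (g *v x - x)"
      by (simp add: matrix_vector_mul_assoc[symmetric] matrix_vector_mult_diff_distrib)
    moreover have "g *v (h *v x - x) \<in> latt" "g *v x - x \<in> latt"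
      using that g h Otilde_plus_latt[OF g] by (simp_all add: Otilde_plus_def)
    ultimately show ?thesis using latt_closed(2) by metis
  qed
  ultimately show ?thesis using g h by (simp add: Otilde_plus_def)
qed

lemma mat_1_Otilde_plus: "mat 1 \<in> Otilde_plus G0"
  using transvection_Otilde_plus[of 0 0] by (simp add: transvection_0 latt_closed)

text \<open>An element of the orbit whose \<open>e1\<close>-coordinate has minimal nonzero absolute value
  has all its pairings with the lattice divisible by that coordinate, which therefore is a unit.\<close>

lemma eichler_criterion:
  assumes x: "x \<in> latt" "rform BL x x = 0" and v: "v \<in> latt" "rform BL x v = 1"
  shows "\<exists>\<gamma>\<in>Otilde_plus G0. \<exists>\<epsilon>::real. \<epsilon> \<noteq> 0 \<and> \<gamma> *v x = \<epsilon> *\<^sub>R axis E1 1"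
proof -
  define Orb where "Orb = (\<lambda>\<gamma>. \<gamma> *v x) ` Otilde_plus G0"
  have O_latt: "y \<in> latt" and O_iso: "rform BL y y = 0" and O_pair: "\<exists>v\<in>latt. rform BL y v = 1" if y: "y \<in> Orb" for y
  proof -
    obtain \<gamma> where \<gamma>: "\<gamma> \<in> Otilde_plus G0" "y = \<gamma> *v x" using y by (auto simp: Orb_def)
    have iso: "rform BL (\<gamma> *v a) (\<gamma> *v b) = rform BL a b" for a b
      using Otilde_plus_isometry[OF \<gamma>(1)] by (simp add: isometry_def)
    show "y \<in> latt" using Otilde_plus_latt[OF \<gamma>(1) x(1)] \<gamma>(2) by simp
    show "rform BL y y = 0" using iso x(2) \<gamma>(2) by simp
    show "\<exists>v\<in>latt. rform BL y v = 1"
      using iso v \<gamma>(2) Otilde_plus_latt[OF \<gamma>(1) v(1)] by (intro bexI[of _ "\<gamma> *v v"]) simp_all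
  qed
  have O_int: "y $ i = of_int \<lfloor>y $ i\<rfloor>" if "y \<in> Orb" for y i
    using O_latt[OF that] by (simp add: latt_def)
  have x_O: "x \<in> Orb" unfolding Orb_def using mat_1_Otilde_plus by force
  have step: "transvection BL u a *v y \<in> Orb"
    if y: "y \<in> Orb" and ua: "u \<in> latt" "rform BL u u = 0" "a \<in> latt" "rform BL u a = 0" for y u a
  proof -
    obtain \<gamma> where "\<gamma> \<in> Otilde_plus G0" "y = \<gamma> *v x" using y by (auto simp: Orb_def)
    then show ?thesis
      using Otilde_plus_mult[OF transvection_Otilde_plus[OF ua]]
      by (auto simp: Orb_def matrix_vector_mul_assoc)
  qed
  note tv = transvection_apply[OF transpose_gramL]
  \<comment> \<open>The four moves make up a Euclidean algorithm on coordinates. \<open>op1\<close>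
    changes the \<open>L1\<close> part by multiples of the \<open>E1\<close>-coordinate,
    \<open>op2\<close> and \<open>op3\<close> add multiples of the \<open>F2\<close>- and
    \<open>E2\<close>-coordinate to \<open>E1\<close>, and \<open>op4\<close> transfers pairings
    with \<open>L0\<close> into the \<open>E2\<close>-coordinate.\<close>
  have op1: "\<exists>y'\<in>Orb. y' $ E1 = y $ E1 \<and> proj1 y' = proj1 y + (y $ E1) *\<^sub>R z" if y: "y \<in> Orb" and z: "z \<in> latt" for y z
  proof (rule bexI)
    let ?u = "axis F1 1 :: real^'m idx"
    have p: "proj1 ?u = 0" by (simp add: vec_idx1_eq_iff axis_def)
    have "emb1 z $ i \<in> \<int>" for i using z by (cases i) (simp_all add: latt_def)
    then have "emb1 z \<in> latt" by (simp add: latt_def)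
    then show "transvection BL ?u (emb1 z) *v y \<in> Orb"
      using y by (intro step) (simp_all add: gramL_rform p latt_closed, simp_all add: axis_def)
    show "(transvection BL ?u (emb1 z) *v y) $ E1 = y $ E1 \<and>
        proj1 (transvection BL ?u (emb1 z) *v y) = proj1 y + (y $ E1) *\<^sub>R z"
      by (simp add: tv gramL_rform p) (simp add: axis_def vec_idx1_eq_iff)
  qed
  have op2: "\<exists>y'\<in>Orb. y' $ E1 = y $ E1 + of_int s * y $ F2 \<and> y' $ F2 = y $ F2 \<and> y' $ E2 = y $ E2 - of_int s * y $ F1"
    if y: "y \<in> Orb" for y and s :: int
  proof (rule bexI)
    let ?u = "axis E2 1 :: real^'m idx" and ?a = "of_int s *\<^sub>R axis E1 1 :: real^'m idx"
    have p: "proj1 ?a = 0" by (simp add: vec_idx1_eq_iff axis_def)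
    have q: "projV (proj1 ?u) = 0" by (simp add: vec_eq_iff axis_def)
    show "transvection BL ?u ?a *v y \<in> Orb"
      using y by (intro step) (simp_all add: gramL_rform gramL1_rform p q latt_closed, simp_all add: axis_def)
    show "(transvection BL ?u ?a *v y) $ E1 = y $ E1 + of_int s * y $ F2 \<and> (transvection BL ?u ?a *v y) $ F2 = y $ F2
       \<and> (transvection BL ?u ?a *v y) $ E2 = y $ E2 - of_int s * y $ F1"
      by (simp add: tv gramL_rform gramL1_rform p q) (simp add: axis_def)
  qed
  have op3: "\<exists>y'\<in>Orb. y' $ E1 = y $ E1 + of_int s * y $ E2" if y: "y \<in> Orb" for y and s :: int
  proof (rule bexI)
    let ?u = "axis F2 1 :: real^'m idx" and ?a = "of_int s *\<^sub>R axis E1 1 :: real^'m idx"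
    have p: "proj1 ?a = 0" by (simp add: vec_idx1_eq_iff axis_def)
    have q: "projV (proj1 ?u) = 0" by (simp add: vec_eq_iff axis_def)
    show "transvection BL ?u ?a *v y \<in> Orb"
      using y by (intro step) (simp_all add: gramL_rform gramL1_rform p q latt_closed, simp_all add: axis_def)
    show "(transvection BL ?u ?a *v y) $ E1 = y $ E1 + of_int s * y $ E2"
      by (simp add: tv gramL_rform gramL1_rform p q) (simp add: axis_def)
  qed
  have op4: "\<exists>y'\<in>Orb. y' $ E1 = y $ E1 \<and> y' $ E2 = y $ E2 - rform BV z (projV (proj1 y))"
    if y: "y \<in> Orb" "y $ F2 = 0" and z: "z \<in> latt" for y z
  proof (rule bexI)
    let ?u = "axis E2 1 :: real^'m idx"
    define a where "a = emb1 (\<chi> i. case i of I1E \<Rightarrow> 0 | I1F \<Rightarrow> 0 | I1V c \<Rightarrow> z $ c)"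
    have a: "a $ E1 = 0" "a $ F1 = 0" "a $ E2 = 0" "a $ F2 = 0" "projV (proj1 a) = z"
      by (simp_all add: a_def vec_eq_iff)
    have "a $ i \<in> \<int>" for i using z by (cases i) (simp_all add: a_def latt_def)
    then have "a \<in> latt" by (simp add: latt_def)
    have q: "projV (proj1 ?u) = 0" by (simp add: vec_eq_iff axis_def)
    show "transvection BL ?u a *v y \<in> Orb"
      using y \<open>a \<in> latt\<close> by (intro step) (simp_all add: gramL_rform gramL1_rform a q latt_closed, simp_all add: axis_def)
    show "(transvection BL ?u a *v y) $ E1 = y $ E1
       \<and> (transvection BL ?u a *v y) $ E2 = y $ E2 - rform BV z (projV (proj1 y))"
      using y by (simp add: tv gramL_rform gramL1_rform a q) (simp add: axis_def)
  qed

  \<comment> \<open>If \<open>E1\<close> vanished on the whole orbit, \<open>op2\<close> and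
    \<open>op3\<close> would force \<open>F2\<close> and \<open>E2\<close> to vanish as well, then
    \<open>op2\<close> the coordinate \<open>F1\<close> and \<open>op4\<close> all pairings with
    \<open>L0\<close>. This contradicts \<open>(x, v) = 1\<close>.\<close>
  have ex: "\<exists>y\<in>Orb. y $ E1 \<noteq> 0"
  proof (rule ccontr)
    assume "\<not> ?thesis"
    then have E1: "y $ E1 = 0" if "y \<in> Orb" for y using that by blast
    have F2: "y $ F2 = 0" and E2: "y $ E2 = 0" if "y \<in> Orb" for y
      using op2[OF that, of 1] op3[OF that, of 1] E1 that by auto
    have F1: "y $ F1 = 0" if "y \<in> Orb" for y
      using op2[OF that, of 1] E2 that by force
    have V: "rform BV z (projV (proj1 y)) = 0" if "y \<in> Orb" "z \<in> latt" for y z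
      using op4[OF that(1) F2[OF that(1)] that(2)] E2 that by force
    have "projV (proj1 v) \<in> latt" using v by (simp add: latt_def)
    then have "rform BL v x = 0"
      using x_O E1 F1 E2 F2 V by (simp add: gramL_rform gramL1_rform)
    then show False using v rformL_commute[of v x] by simp
  qed
  define wt where "wt y = nat \<bar>\<lfloor>y $ E1\<rfloor>\<bar>" for y :: "real^'m idx"
  obtain y0 where y0: "y0 \<in> Orb" "y0 $ E1 \<noteq> 0" and least: "\<And>y. y \<in> Orb \<and> y $ E1 \<noteq> 0 \<Longrightarrow> wt y0 \<le> wt y"
    using ex_has_least_nat[of "\<lambda>y. y \<in> Orb \<and> y $ E1 \<noteq> 0" _ wt] ex by blast
  define A where "A = \<lfloor>y0 $ E1\<rfloor>"
  have A: "y0 $ E1 = of_int A" "A \<noteq> 0" using O_int[OF y0(1), of E1] y0(2) by (auto simp: A_def)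
  have min: "\<bar>A\<bar> \<le> \<bar>B\<bar>" if "y \<in> Orb" "y $ E1 = of_int B" "B \<noteq> 0" for y B
    using least[of y] that by (simp add: wt_def A_def)
  \<comment> \<open>Euclidean division produces a smaller nonzero \<open>E1\<close>-coordinate:
    \<open>d\<close> itself if \<open>d\<close> divides \<open>A\<close>, and \<open>A mod d\<close>
    otherwise.\<close>
  have small: "d = 0" if "\<bar>d\<bar> < \<bar>A\<bar>" and *: "\<And>s::int. \<exists>y\<in>Orb. y $ E1 = of_int (A + s * d)" for d
  proof (rule ccontr)
    assume d: "d \<noteq> 0"
    show False
    proof (cases "A mod d = 0")
      case True
      then have "A = A div d * d" by (metis add.right_neutral div_mult_mod_eq)
      then have "A + (1 - A div d) * d = d" by (simp add: left_diff_distrib)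
      then show False using *[of "1 - A div d"] min d that(1) by fastforce
    next
      case False
      have "A + (- (A div d)) * d = A mod d" by (simp add: minus_div_mult_eq_mod)
      moreover have "\<bar>A mod d\<bar> < \<bar>d\<bar>" using d by (rule abs_mod_less)
      ultimately show False using *[of "- (A div d)"] min False that(1) by fastforce
    qed
  qed
  have F2: "A dvd B" if y: "y \<in> Orb" "y $ E1 = of_int A" "y $ F2 = of_int B" for y B
  proof -
    \<comment> \<open>This multiple replaces \<open>B\<close> by its remainder modulo
      \<open>A\<close>, to which \<open>small\<close> applies.\<close>
    have z: "axis I1F (of_int (- (B div A))) \<in> latt" by (simp add: latt_def axis_def)
    obtain y' where y': "y' \<in> Orb" "y' $ E1 = of_int A" "proj1 y' = proj1 y + (y $ E1) *\<^sub>R axis I1F (of_int (- (B div A)))"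
      using op1[OF y(1) z] y(2) by auto
    from arg_cong[OF y'(3), of "\<lambda>v. v $ I1F"] have "y' $ F2 = of_int (B - A * (B div A))"
      using y by (simp add: axis_def)
    then have "y' $ F2 = of_int (B mod A)" by (simp only: minus_mult_div_eq_mod)
    then have "\<exists>y\<in>Orb. y $ E1 = of_int (A + s * (B mod A))" for s
      using op2[OF y'(1), of s] y'(2) by fastforce
    then have "B mod A = 0" using A by (intro small abs_mod_less)
    then show ?thesis by (rule mod_0_imp_dvd)
  qed
  have E2: "A dvd B" if y: "y \<in> Orb" "y $ E1 = of_int A" "y $ E2 = of_int B" for y B
  proof -
    have z: "axis I1E (of_int (- (B div A))) \<in> latt" by (simp add: latt_def axis_def)
    obtain y' where y': "y' \<in> Orb" "y' $ E1 = of_int A" "proj1 y' = proj1 y + (y $ E1) *\<^sub>R axis I1E (of_int (- (B div A)))"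
      using op1[OF y(1) z] y(2) by auto
    from arg_cong[OF y'(3), of "\<lambda>v. v $ I1E"] have "y' $ E2 = of_int (B - A * (B div A))"
      using y by (simp add: axis_def)
    then have "y' $ E2 = of_int (B mod A)" by (simp only: minus_mult_div_eq_mod)
    then have "\<exists>y\<in>Orb. y $ E1 = of_int (A + s * (B mod A))" for s
      using op3[OF y'(1), of s] y'(2) by fastforce
    then have "B mod A = 0" using A by (intro small abs_mod_less)
    then show ?thesis by (rule mod_0_imp_dvd)
  qed
  \<comment> \<open>The coordinates on the second hyperbolic plane are cleared: \<open>op4\<close>
    requires \<open>F2\<close> to be 0, and with \<open>E2\<close> equal to 0 the next two moves
    write exactly the wanted quantity into \<open>E2\<close>.\<close>
  obtain k l :: int where kl: "y0 $ E2 = of_int (A * k)" "y0 $ F2 = of_int (A * l)"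
    using F2[OF y0(1) A(1) O_int[OF y0(1)]] E2[OF y0(1) A(1) O_int[OF y0(1)]] O_int[OF y0(1)]
    by (metis dvd_def)
  have "(\<chi> i. if i = I1E then - of_int k else if i = I1F then - of_int l else 0) \<in> latt"
    by (simp add: latt_def)
  from op1[OF y0(1) this] obtain y1 where y1: "y1 \<in> Orb" "y1 $ E1 = of_int A" and p1: "proj1 y1 =
      proj1 y0 + (y0 $ E1) *\<^sub>R (\<chi> i. if i = I1E then - of_int k else if i = I1F then - of_int l else 0)"
    using A by auto
  have y1_0: "y1 $ E2 = 0" "y1 $ F2 = 0"
    using arg_cong[OF p1, of "\<lambda>v. v $ I1E"] arg_cong[OF p1, of "\<lambda>v. v $ I1F"] kl A by simp_all
  \<comment> \<open>The \<open>F1\<close>-coordinate is moved to position \<open>E2\<close>, where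
    divisibility by \<open>A\<close> is already known; below, \<open>op4\<close> does the same for
    the pairings with \<open>L0\<close>.\<close>
  obtain y2 where y2: "y2 \<in> Orb" "y2 $ E1 = of_int A" "y2 $ E2 = - y1 $ F1"
    using op2[OF y1(1), of 1] y1 y1_0 by auto
  have dF1: "A dvd \<lfloor>y1 $ F1\<rfloor>"
  proof -
    have "y2 $ E2 = of_int (- \<lfloor>y1 $ F1\<rfloor>)" using y2(3) O_int[OF y1(1), of F1] by simp
    from E2[OF y2(1,2) this] show ?thesis by simp
  qed
  have dV: "\<exists>B. rform BV z (projV (proj1 y1)) = of_int (A * B)" if z: "z \<in> latt" for z
  proof -
    obtain y3 where y3: "y3 \<in> Orb" "y3 $ E1 = of_int A" "y3 $ E2 = - rform BV z (projV (proj1 y1))"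
      using op4[OF y1(1) y1_0(2) z] y1 y1_0 by auto
    obtain B where B: "y3 $ E2 = of_int (A * B)" using E2[OF y3(1,2) O_int[OF y3(1)]] O_int[OF y3(1), of E2] by (metis dvd_def)
    have "rform BV z (projV (proj1 y1)) = of_int (A * (- B))" using y3(3) B by simp
    then show ?thesis by blast
  qed
  obtain v1 where v1: "v1 \<in> latt" "rform BL y1 v1 = 1" using O_pair[OF y1(1)] by blast
  have "projV (proj1 v1) \<in> latt" using v1 by (simp add: latt_def)
  then obtain B where B: "rform BV (projV (proj1 v1)) (projV (proj1 y1)) = of_int (A * B)" using dV by blast
  obtain C where C: "y1 $ F1 = of_int (A * C)" using dF1 O_int[OF y1(1), of F1] by (metis dvd_def)
  obtain p q :: int where pq: "v1 $ E1 = of_int p" "v1 $ F1 = of_int q"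
    using v1(1) by (auto simp: latt_def) (meson Ints_cases)
  have "rform BL v1 y1 = of_int (A * (q + C * p + B))"
    using y1 y1_0 B C pq by (simp add: gramL_rform gramL1_rform algebra_simps)
  then have "of_int (A * (q + C * p + B)) = (1 :: real)"
    using v1(2) rformL_commute[of y1 v1] by simp
  then have "A * (q + C * p + B) = 1" by (simp only: of_int_eq_1_iff)
  then have A1: "A * A = 1" by (metis zmult_eq_1_iff mult_minus_left mult_minus_right mult_1 minus_minus)
  \<comment> \<open>Since \<open>A * A = 1\<close>, this translation cancels the entire
    \<open>L1\<close> part. Isotropy then forces the \<open>F1\<close>-coordinate to vanish.\<close>
  have z: "- of_int A *\<^sub>R proj1 y1 \<in> latt"
  proof -
    have "proj1 y1 $ i \<in> \<int>" for i using O_latt[OF y1(1)] by (cases i) (simp_all add: latt_def)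
    then show ?thesis by (simp add: latt_def)
  qed
  obtain y4 where y4: "y4 \<in> Orb" "y4 $ E1 = of_int A" and p4: "proj1 y4 = proj1 y1 + (y1 $ E1) *\<^sub>R (- of_int A *\<^sub>R proj1 y1)"
    using op1[OF y1(1) z] y1 by auto
  have "real_of_int A * real_of_int A = 1" using A1 by (metis of_int_1 of_int_mult)
  then have p4: "proj1 y4 = 0" using p4 y1 by simp
  then have "proj1 y4 $ I1E = 0" "proj1 y4 $ I1F = 0" "proj1 y4 $ I1V c = 0" for c by simp_all
  moreover have "y4 $ F1 = 0" using O_iso[OF y4(1)] A y4 p4 by (simp add: gramL_rform)
  ultimately have "y4 = of_int A *\<^sub>R axis E1 1"
    using y4(2) by (simp add: vec_idx_eq_iff axis_def)
  then show ?thesis using y4(1) A(2) unfolding Orb_def by (metis (no_types, lifting) imageE of_int_eq_0_iff)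
qed

end

subsection \<open>Isotropic planes and the cyclicity condition\<close>

lemma int_subgroup_generator:
  fixes S :: "int set"
  assumes ne: "S \<noteq> {}" and diff: "\<And>x y. x \<in> S \<Longrightarrow> y \<in> S \<Longrightarrow> x - y \<in> S"
  shows "\<exists>d\<in>S. \<forall>x\<in>S. d dvd x"
proof -
  have 0: "0 \<in> S" using ne diff by fastforce
  have neg: "- x \<in> S" if "x \<in> S" for x using diff[OF 0 that] by simp
  have add: "x + y \<in> S" if "x \<in> S" "y \<in> S" for x y using diff[OF that(1) neg[OF that(2)]] by simp
  show ?thesis
  proof (cases "\<exists>x\<in>S. x \<noteq> 0")
    case False
    then show ?thesis using 0 by force
  next
    case True
    then obtain d where d: "d \<in> S" "d \<noteq> 0" and least: "\<And>y. y \<in> S \<and> y \<noteq> 0 \<Longrightarrow> nat \<bar>d\<bar> \<le> nat \<bar>y\<bar>"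
      using ex_has_least_nat[of "\<lambda>y. y \<in> S \<and> y \<noteq> 0" _ "\<lambda>y. nat \<bar>y\<bar>"] by blast
    have "int n * d \<in> S" for n by (induction n) (simp_all add: 0 add d distrib_right)
    then have mult: "k * d \<in> S" for k
      by (cases k rule: int_cases2) (use neg in force)+
    have "d dvd x" if "x \<in> S" for x
    proof -
      have "x mod d \<in> S"
        using diff[OF that mult[of "x div d"]] by (simp add: minus_div_mult_eq_mod)
      moreover have "\<bar>x mod d\<bar> < \<bar>d\<bar>" using d(2) by (rule abs_mod_less)
      ultimately have "x mod d = 0" using least[of "x mod d"] by force
      then show ?thesis by (rule mod_0_imp_dvd)
    qed
    then show ?thesis using d by blast
  qed
qed

section \<open>Coset arithmetic in the discriminant group\<close>

lemma dcoset_eqD: "dcoset x = dcoset y \<Longrightarrow> x - y \<in> latt"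
proof -
  assume "dcoset x = dcoset y"
  moreover have "x \<in> dcoset x" unfolding dcoset_def using latt_closed(1) by force
  ultimately obtain v where "v \<in> latt" "x = y + v" by (auto simp: dcoset_def)
  then show ?thesis by simp
qed

lemma cplus_dcoset: "cplus (dcoset x) (dcoset y) = dcoset (x + y)"
proof (intro set_eqI iffI)
  fix z assume "z \<in> cplus (dcoset x) (dcoset y)"
  then obtain v w where "v \<in> latt" "w \<in> latt" "z = (x + v) + (y + w)"
    by (auto simp: cplus_def dcoset_def)
  then have "z = (x + y) + (v + w)" "v + w \<in> latt" by (auto intro: latt_closed)
  then show "z \<in> dcoset (x + y)" unfolding dcoset_def by blast
next
  fix z assume "z \<in> dcoset (x + y)"
  then obtain v where "v \<in> latt" "z = (x + v) + (y + 0)" by (auto simp: dcoset_def)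
  then show "z \<in> cplus (dcoset x) (dcoset y)"
    unfolding cplus_def dcoset_def using latt_closed(1) by blast
qed

lemma uminus_dcoset: "uminus ` dcoset x = dcoset (- x)"
proof (intro set_eqI iffI)
  fix z assume "z \<in> uminus ` dcoset x"
  then obtain v where "v \<in> latt" "z = - (x + v)" by (auto simp: dcoset_def)
  then have "z = - x + - v" "- v \<in> latt" by (simp_all add: latt_closed)
  then show "z \<in> dcoset (- x)" unfolding dcoset_def by blast
next
  fix z assume "z \<in> dcoset (- x)"
  then obtain v where "v \<in> latt" "z = - x + v" by (auto simp: dcoset_def)
  then have "z = - (x + - v)" "- v \<in> latt" by (simp_all add: latt_closed)
  then show "z \<in> uminus ` dcoset x" unfolding dcoset_def by blast
qed

context even_negdef begin

lemma gramL_nondegenerate_latt: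
  assumes "\<And>w. w \<in> latt \<Longrightarrow> rform BL y w = 0"
  shows "y = 0"
proof (rule gramL_nondegenerate)
  fix z
  have "(BL *v y) $ i = 0" for i
    using assms[of "axis i 1"] rformL_commute[of y "axis i 1"] by (simp add: latt_closed rform_def inner_axis')
  then have "BL *v y = 0" by (simp add: vec_eq_iff)
  then show "rform BL y z = 0" using rformL_commute[of y z] by (simp add: rform_def)
qed

text \<open>Let \<open>y\<close> generate the dual vectors of the isotropic space modulo its lattice vectors. A lattice
  vector generating the values of an integral functional that kills \<open>y\<close> is primitive in the dual.\<close>

lemma isotropic_unimodular_vector:
  assumes cyc: "iso_subgroups_cyclic BL"
    and P: "subspace P" "\<And>x y. x \<in> P \<Longrightarrow> y \<in> P \<Longrightarrow> rform BL x y = 0"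
    and q: "q1 \<in> P" "q1 \<in> latt" "q2 \<in> P" "q2 \<in> latt"
    and indep: "\<And>r s. r *\<^sub>R q1 + s *\<^sub>R q2 = 0 \<Longrightarrow> r = 0 \<and> s = 0"
  shows "\<exists>e\<in>P \<inter> latt. \<exists>v\<in>latt. rform BL e v = 1"
proof -
  \<comment> \<open>The cosets of \<open>D\<close> form the isotropic subgroup to which cyclicity is
    applied.\<close>
  define D where "D = P \<inter> dual BL"
  have D_diff: "x - y \<in> D" and D_add: "x + y \<in> D" and D_neg: "- x \<in> D" if "x \<in> D" "y \<in> D" for x y
    using that P(1) by (auto simp: D_def dual_def rform_linear intro: subspace_diff subspace_add subspace_neg)
  have D_latt: "x \<in> D" if "x \<in> P" "x \<in> latt" for x using that latt_subset_dual by (auto simp: D_def)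
  have "disc_subgroup BL (dcoset ` D)"
    unfolding disc_subgroup_def
  proof (intro conjI ballI)
    show "dcoset ` D \<subseteq> discA BL" by (auto simp: discA_def D_def)
    have "dcoset 0 = (latt :: (real^'m idx) set)" by (simp add: dcoset_def)
    moreover have "0 \<in> D" using D_latt subspace_0[OF P(1)] latt_closed(1) by blast
    ultimately show "latt \<in> dcoset ` D" by (metis image_eqI)
  qed (auto simp: cplus_dcoset uminus_dcoset D_add D_neg)
  moreover have "disc_isotropic BL (dcoset ` D)"
    unfolding disc_isotropic_def
  proof (intro ballI)
    fix a x assume "a \<in> dcoset ` D" "x \<in> a"
    then obtain y v where y: "y \<in> D" and v: "v \<in> latt" and x: "x = y + v" by (auto simp: dcoset_def)
    obtain m :: int where m: "rform BL y v = of_int m"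
      using y v by (auto simp: D_def dual_def elim: Ints_cases)
    obtain m' :: int where m': "rform BL v v = 2 * of_int m'" using rformL_even[OF v] by blast
    have "rform BL x x = 2 * of_int (m + m')"
      using P(2)[of y y] y m m' rformL_commute[of v y] by (simp add: x rform_linear D_def)
    then show "\<exists>m::int. rform BL x x = 2 * of_int m" by blast
  qed
  ultimately have "disc_cyclic BL (dcoset ` D)" using cyc by (simp add: iso_subgroups_cyclic_def)
  then obtain x0 where H: "dcoset ` D = {dcoset (of_int m *\<^sub>R x0) |m::int. True}"
    by (auto simp: disc_cyclic_def)
  have "dcoset (of_int 1 *\<^sub>R x0) \<in> dcoset ` D" unfolding H by blast
  \<comment> \<open>The cyclic generator \<open>x0\<close> is only known to be a dual vector; it is
    replaced by a representative of its coset inside the isotropic space.\<close>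
  then obtain y0 where y0: "y0 \<in> D" "dcoset x0 = dcoset y0" by auto
  have gen0: "\<exists>j::int. x - of_int j *\<^sub>R y0 \<in> latt" if x: "x \<in> D" for x
  proof -
    have "dcoset x \<in> {dcoset (of_int m *\<^sub>R x0) |m::int. True}" using x unfolding H[symmetric] by blast
    then obtain j :: int where "dcoset x = dcoset (of_int j *\<^sub>R x0)" by blast
    then have "x - of_int j *\<^sub>R x0 \<in> latt" by (rule dcoset_eqD)
    moreover have "of_int j *\<^sub>R (x0 - y0) \<in> latt"
      using dcoset_eqD[OF y0(2)] by (simp add: latt_closed(5))
    ultimately have "(x - of_int j *\<^sub>R x0) + of_int j *\<^sub>R (x0 - y0) \<in> latt" by (rule latt_closed(2))
    then show ?thesis by (auto simp: algebra_simps)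
  qed
  have q1: "q1 \<noteq> 0" using indep[of 1 0] by auto
  \<comment> \<open>The functional below needs \<open>y\<close> nonzero. If \<open>y0 = 0\<close>,
    every element of \<open>D\<close> is a lattice vector, and \<open>q1\<close> serves as generator
    with coefficient 0.\<close>
  obtain y where y: "y \<in> D" "y \<noteq> 0" and gen: "\<And>x. x \<in> D \<Longrightarrow> \<exists>j::int. x - of_int j *\<^sub>R y \<in> latt"
  proof (cases "y0 = 0")
    case True
    then have "\<exists>j::int. x - of_int j *\<^sub>R q1 \<in> latt" if "x \<in> D" for x
      using gen0[OF that] by (intro exI[of _ 0]) simp
    then show ?thesis using that[of q1] q q1 D_latt by blast
  next
    case False
    then show ?thesis using that[of y0] y0 gen0 by blast
  qed
  obtain w2 where w2: "w2 \<in> latt" "rform BL y w2 \<noteq> 0" using gramL_nondegenerate_latt y by blast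
  \<comment> \<open>A 2 by 2 determinant of pairings of \<open>x\<close> and \<open>y\<close> with
    \<open>w1\<close> and \<open>w2\<close>. It is integral on \<open>D\<close> and vanishes at
    \<open>x = y\<close>. If it vanished at \<open>q1\<close> and \<open>q2\<close> for every
    \<open>w1\<close>, nondegeneracy would make both proportional to \<open>y\<close>, against their
    independence.\<close>
  define \<phi> where "\<phi> w1 x = rform BL x w1 * rform BL y w2 - rform BL x w2 * rform BL y w1" for w1 x
  have "\<exists>w1\<in>latt. \<phi> w1 q1 \<noteq> 0 \<or> \<phi> w1 q2 \<noteq> 0"
  proof (rule ccontr)
    assume "\<not> ?thesis"
    then have z: "\<phi> w1 q1 = 0" "\<phi> w1 q2 = 0" if "w1 \<in> latt" for w1 using that by auto
    have "rform BL y w2 *\<^sub>R q - rform BL q w2 *\<^sub>R y = 0" if "\<And>w1. w1 \<in> latt \<Longrightarrow> \<phi> w1 q = 0" for q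
      by (rule gramL_nondegenerate_latt) (use that in \<open>simp add: \<phi>_def rform_linear mult.commute\<close>)
    then have e: "rform BL y w2 *\<^sub>R q1 = rform BL q1 w2 *\<^sub>R y" "rform BL y w2 *\<^sub>R q2 = rform BL q2 w2 *\<^sub>R y"
      using z by simp_all
    have "(rform BL q2 w2 * rform BL y w2) *\<^sub>R q1 + (- (rform BL q1 w2 * rform BL y w2)) *\<^sub>R q2
        = rform BL q2 w2 *\<^sub>R (rform BL y w2 *\<^sub>R q1) - rform BL q1 w2 *\<^sub>R (rform BL y w2 *\<^sub>R q2)"
      by simp
    also have "\<dots> = 0" unfolding e by (simp add: mult.commute)
    finally have "rform BL q1 w2 * rform BL y w2 = 0" using indep by fastforce
    then have "rform BL y w2 *\<^sub>R q1 = 0" using e(1) w2(2) by simp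
    then show False using w2(2) q1 by simp
  qed
  then obtain w1 q where w1: "w1 \<in> latt" and q': "q \<in> P" "q \<in> latt" "\<phi> w1 q \<noteq> 0" using q by blast
  define \<psi> where "\<psi> = \<phi> w1"
  have lin: "\<psi> (a - b) = \<psi> a - \<psi> b" "\<psi> (r *\<^sub>R a) = r * \<psi> a" "\<psi> y = 0" for a b r
    by (simp_all add: \<psi>_def \<phi>_def rform_linear algebra_simps)
  have int: "\<psi> x = of_int \<lfloor>\<psi> x\<rfloor>" if "x \<in> D" for x
  proof -
    have "\<psi> x \<in> \<int>"
      using that y(1) w1 w2(1) unfolding \<psi>_def \<phi>_def D_def dual_def by auto
    then show ?thesis by simp
  qed
  have "\<exists>d\<in>(\<lambda>x. \<lfloor>\<psi> x\<rfloor>) ` (P \<inter> latt). \<forall>x\<in>(\<lambda>x. \<lfloor>\<psi> x\<rfloor>) ` (P \<inter> latt). d dvd x"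
  proof (rule int_subgroup_generator)
    show "(\<lambda>x. \<lfloor>\<psi> x\<rfloor>) ` (P \<inter> latt) \<noteq> {}" using q' by blast
    fix a b assume "a \<in> (\<lambda>x. \<lfloor>\<psi> x\<rfloor>) ` (P \<inter> latt)" "b \<in> (\<lambda>x. \<lfloor>\<psi> x\<rfloor>) ` (P \<inter> latt)"
    then obtain x z where xz: "x \<in> P \<inter> latt" "z \<in> P \<inter> latt" "a = \<lfloor>\<psi> x\<rfloor>" "b = \<lfloor>\<psi> z\<rfloor>" by blast
    then have "\<psi> (x - z) = of_int (a - b)"
      using int[of x] int[of z] D_latt by (simp add: lin)
    then have "a - b = \<lfloor>\<psi> (x - z)\<rfloor>" by simp
    moreover have "x - z \<in> P \<inter> latt"
      using xz P(1) by (simp add: subspace_diff latt_closed)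
    ultimately show "a - b \<in> (\<lambda>x. \<lfloor>\<psi> x\<rfloor>) ` (P \<inter> latt)" by blast
  qed
  then obtain e where e: "e \<in> P \<inter> latt" and edvd: "\<And>x. x \<in> P \<inter> latt \<Longrightarrow> \<lfloor>\<psi> e\<rfloor> dvd \<lfloor>\<psi> x\<rfloor>" by blast
  have e0: "\<lfloor>\<psi> e\<rfloor> \<noteq> 0"
  proof
    assume "\<lfloor>\<psi> e\<rfloor> = 0"
    then have "\<lfloor>\<psi> q\<rfloor> = 0" using edvd[of q] q' by simp
    then show False using int[OF D_latt[OF q'(1,2)]] q'(3) by (simp add: \<psi>_def)
  qed
  \<comment> \<open>Subtracting a multiple of \<open>y\<close> brings \<open>x\<close> into the
    lattice without changing \<psi>, so the divisibility extends from lattice vectors to dual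
    vectors.\<close>
  have dvdD: "\<lfloor>\<psi> e\<rfloor> dvd \<lfloor>\<psi> x\<rfloor>" if x: "x \<in> D" for x
  proof -
    obtain j :: int where j: "x - of_int j *\<^sub>R y \<in> latt" using gen[OF x] by blast
    moreover have "x - of_int j *\<^sub>R y \<in> P"
      using x y P(1) by (simp add: D_def subspace_diff subspace_scale)
    moreover have "\<psi> (x - of_int j *\<^sub>R y) = \<psi> x" by (simp add: lin)
    ultimately show ?thesis using edvd[of "x - of_int j *\<^sub>R y"] by simp
  qed
  have eint: "rform BL e v = of_int \<lfloor>rform BL e v\<rfloor>" if "v \<in> latt" for v
    using D_latt[of e] e that by (simp add: D_def dual_def)
  have "\<exists>d\<in>(\<lambda>v. \<lfloor>rform BL e v\<rfloor>) ` latt. \<forall>x\<in>(\<lambda>v. \<lfloor>rform BL e v\<rfloor>) ` latt. d dvd x"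
  proof (rule int_subgroup_generator)
    show "(\<lambda>v. \<lfloor>rform BL e v\<rfloor>) ` latt \<noteq> {}" using latt_closed(1) by blast
    fix a b assume "a \<in> (\<lambda>v. \<lfloor>rform BL e v\<rfloor>) ` latt" "b \<in> (\<lambda>v. \<lfloor>rform BL e v\<rfloor>) ` latt"
    then obtain x z where xz: "x \<in> latt" "z \<in> latt" "a = \<lfloor>rform BL e x\<rfloor>" "b = \<lfloor>rform BL e z\<rfloor>" by blast
    then have "rform BL e (x - z) = of_int (a - b)"
      using eint[of x] eint[of z] by (simp add: rform_linear)
    then have "a - b = \<lfloor>rform BL e (x - z)\<rfloor>" by simp
    then show "a - b \<in> (\<lambda>v. \<lfloor>rform BL e v\<rfloor>) ` latt" using latt_closed(3)[OF xz(1,2)] by blast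
  qed
  then obtain v where v: "v \<in> latt" and vdvd: "\<And>w. w \<in> latt \<Longrightarrow> \<lfloor>rform BL e v\<rfloor> dvd \<lfloor>rform BL e w\<rfloor>" by blast
  \<comment> \<open>\<open>c\<close> generates the ideal \<open>(e, L)\<close>, so
    \<open>e / c\<close> is again dual. By \<open>dvdD\<close>, its value
    \<open>\<psi> e / c\<close> is an integral multiple of \<open>\<psi> e\<close>, which leaves
    only \<open>c = 1\<close> and \<open>c = -1\<close>.\<close>
  define c where "c = \<lfloor>rform BL e v\<rfloor>"
  have c: "rform BL e v = of_int c" using eint[OF v] by (simp add: c_def)
  have c0: "c \<noteq> 0"
  proof
    assume "c = 0"
    then have "rform BL e w = 0" if "w \<in> latt" for w
      using vdvd[OF that] eint[OF that] by (simp add: c_def)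
    then have "e = 0" by (rule gramL_nondegenerate_latt)
    then show False using e0 lin(2)[of 0 0] by simp
  qed
  have "(1 / of_int c) *\<^sub>R e \<in> dual BL"
    unfolding dual_def
  proof (intro CollectI ballI)
    fix w :: "real^'m idx" assume w: "w \<in> latt"
    obtain k where "\<lfloor>rform BL e w\<rfloor> = c * k" using vdvd[OF w] by (auto simp: c_def)
    then have "rform BL e w = of_int c * of_int k" using eint[OF w] by (metis of_int_mult)
    then show "rform BL ((1 / of_int c) *\<^sub>R e) w \<in> \<int>" using c0 by (simp add: rform_linear)
  qed
  then have D: "(1 / of_int c) *\<^sub>R e \<in> D" using e P(1) by (simp add: D_def subspace_scale)
  from dvdD[OF this] obtain k where k: "\<lfloor>\<psi> ((1 / of_int c) *\<^sub>R e)\<rfloor> = \<lfloor>\<psi> e\<rfloor> * k" by (auto simp: dvd_def)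
  have "\<psi> e / of_int c = of_int \<lfloor>\<psi> e\<rfloor> * of_int k"
    using int[OF D] k by (simp add: lin)
  moreover have "\<psi> e = of_int \<lfloor>\<psi> e\<rfloor>" using int D_latt e by blast
  ultimately have "of_int \<lfloor>\<psi> e\<rfloor> / of_int c = (of_int \<lfloor>\<psi> e\<rfloor> * of_int k :: real)" by metis
  then have "of_int (c * k) = (1 :: real)" using c0 e0 by (simp add: field_simps)
  then have "c * k = 1" by (simp only: of_int_eq_1_iff)
  then have "c = 1 \<or> c = - 1" by (simp add: zmult_eq_1_iff) auto
  then show ?thesis
  proof
    assume "c = 1"
    then show ?thesis using e v c by auto
  next
    assume "c = - 1"
    then have "rform BL e (- v) = 1" using c by (simp add: rform_linear)
    then show ?thesis using e latt_closed(4)[OF v] by blast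
  qed
qed

end

subsection \<open>Uniqueness of Fourier coefficients\<close>

text \<open>The finite set \<open>A\<close> depends on the majorant \<open>b\<close> alone, so the
  bound is uniform over all families dominated by \<open>b\<close>. It serves the averaging argument
  for coefficients as well as the limit at the boundary.\<close>

lemma dominated_tail:
  fixes b :: "'s \<Rightarrow> 'b::real_normed_vector" and \<epsilon> :: real
  assumes "(\<lambda>s. norm (b s)) summable_on S" "\<epsilon> > 0"
  obtains A where "finite A" "A \<subseteq> S"
    "\<And>(f :: 's \<Rightarrow> complex) x. (f has_sum x) (S - A) \<Longrightarrow> (\<And>s. s \<in> S - A \<Longrightarrow> norm (f s) \<le> norm (b s)) \<Longrightarrow> norm x \<le> \<epsilon>"
proof -
  obtain T where T: "((\<lambda>s. norm (b s)) has_sum T) S" using assms(1) by (auto simp: summable_on_def)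
  obtain A where A: "finite A" "A \<subseteq> S" "dist (sum (\<lambda>s. norm (b s)) A) T \<le> \<epsilon>"
    using has_sum_finite_approximation[OF T assms(2)] by blast
  have R: "((\<lambda>s. norm (b s)) has_sum (T - sum (\<lambda>s. norm (b s)) A)) (S - A)"
    using T A by (intro has_sum_Diff has_sum_finite) auto
  show thesis
  proof (rule that[OF A(1,2)])
    fix f :: "'s \<Rightarrow> complex" and x
    assume f: "(f has_sum x) (S - A)" and le: "\<And>s. s \<in> S - A \<Longrightarrow> norm (f s) \<le> norm (b s)"
    have "f summable_on (S - A)" using f by (rule has_sum_imp_summable)
    then have "(\<lambda>s. norm (f s)) summable_on (S - A)"
      by (simp add: summable_on_iff_abs_summable_on_complex[symmetric])
    then obtain n where n: "((\<lambda>s. norm (f s)) has_sum n) (S - A)" by (auto simp: summable_on_def)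
    have "norm x \<le> n" by (rule norm_has_sum_bound[OF n f])
    also have "n \<le> T - sum (\<lambda>s. norm (b s)) A" by (rule has_sum_mono[OF n R le])
    also have "\<dots> \<le> \<epsilon>" using A(3) by (simp add: dist_real_def)
    finally show "norm x \<le> \<epsilon>" .
  qed
qed

lemma has_sum_finite_sum:
  fixes f :: "'i \<Rightarrow> 's \<Rightarrow> 'b::topological_comm_monoid_add"
  assumes "finite I" "\<And>i. i \<in> I \<Longrightarrow> (f i has_sum c i) S"
  shows "((\<lambda>s. \<Sum>i\<in>I. f i s) has_sum (\<Sum>i\<in>I. c i)) S"
  using assms by (induction I) (auto intro!: has_sum_add)

text \<open>Orthogonality of characters of a cyclic group. The bound
  \<open>\<bar>m\<bar> < N\<close> excludes the nonzero multiples of \<open>N\<close>, for which the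
  average would be 1.\<close>

lemma cis_average:
  fixes m :: int and N :: nat
  assumes N: "N > 0"
  defines "g \<equiv> (\<Sum>k<N. cis (2 * pi * of_int m * real k / N)) / of_nat N"
  shows "norm g \<le> 1" and "m = 0 \<Longrightarrow> g = 1" and "m \<noteq> 0 \<Longrightarrow> \<bar>m\<bar> < int N \<Longrightarrow> g = 0"
proof -
  have "norm (\<Sum>k<N. cis (2 * pi * of_int m * real k / N)) \<le> (\<Sum>k<N. 1)"
    by (rule sum_norm_le) simp
  then show "norm g \<le> 1" using N by (simp add: g_def norm_divide field_simps)
  show "m = 0 \<Longrightarrow> g = 1" using N by (simp add: g_def)
  assume m: "m \<noteq> 0" "\<bar>m\<bar> < int N"
  define z where "z = cis (2 * pi * of_int m / N)"
  have zk: "cis (2 * pi * of_int m * real k / N) = z ^ k" for k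
    unfolding z_def Complex.DeMoivre by (rule arg_cong[of _ _ cis]) simp
  have "z ^ N = 1" using N unfolding zk[symmetric] by simp
  moreover have "z \<noteq> 1"
  proof
    assume "z = 1"
    then have "cos (2 * pi * of_int m / N) = 1" by (simp add: z_def complex_eq_iff)
    then obtain n :: int where "2 * pi * of_int m / N = n * 2 * pi" by (auto simp: cos_one_2pi_int)
    then have "real_of_int m = of_int (n * int N)" using N by (simp add: field_simps)
    then have "m = n * int N" by (simp only: of_int_eq_iff)
    then show False using m by (cases "n = 0") (auto simp: abs_mult mult_le_cancel_right1)
  qed
  ultimately show "g = 0" unfolding g_def zk by (simp add: geometric_sum)
qed

text \<open>Averaging over \<open>X \<in> (1/N)\<int>\<^sup>n mod \<int>\<^sup>n\<close> isolates the frequencies congruent to \<open>p s0\<close> modulo \<open>N\<close>;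
  then \<open>N\<close> tends to infinity.\<close>

lemma trigonometric_series_unique:
  fixes b :: "'s \<Rightarrow> complex" and p :: "'s \<Rightarrow> 'n::finite \<Rightarrow> int"
  assumes sum0: "\<And>X :: 'n \<Rightarrow> real. ((\<lambda>s. b s * cis (2 * pi * (\<Sum>i\<in>UNIV. of_int (p s i) * X i))) has_sum 0) S"
    and inj: "inj_on p S" and s0: "s0 \<in> S"
  shows "b s0 = 0"
proof (rule ccontr)
  assume b0: "b s0 \<noteq> 0"
  have "(\<lambda>s. b s * cis (2 * pi * (\<Sum>i\<in>UNIV. of_int (p s i) * 0))) summable_on S"
    using sum0[of "\<lambda>_. 0"] by (rule has_sum_imp_summable)
  then have "(\<lambda>s. norm (b s)) summable_on S"
    by (simp add: summable_on_iff_abs_summable_on_complex[of b])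
  then obtain A where A: "finite A" "A \<subseteq> S" and tail:
    "\<And>(f :: 's \<Rightarrow> complex) x. (f has_sum x) (S - A) \<Longrightarrow> (\<And>s. s \<in> S - A \<Longrightarrow> norm (f s) \<le> norm (b s))
       \<Longrightarrow> norm x \<le> norm (b s0) / 2"
    by (rule dominated_tail[where \<epsilon> = "norm (b s0) / 2"]) (use b0 in auto)
  \<comment> \<open>Larger than every frequency difference occurring in \<open>A\<close>, so that
    inside \<open>A\<close> congruence modulo \<open>N\<close> means equality.\<close>
  define N where "N = Suc (\<Sum>s\<in>A. \<Sum>i\<in>UNIV. nat \<bar>p s i - p s0 i\<bar>)"
  have N: "N > 0" by (simp add: N_def)
  have bound: "\<bar>p s i - p s0 i\<bar> < int N" if "s \<in> A" for s i
  proof -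
    have "nat \<bar>p s i - p s0 i\<bar> \<le> (\<Sum>i\<in>UNIV. nat \<bar>p s i - p s0 i\<bar>)"
      by (rule member_le_sum) simp_all
    also have "\<dots> \<le> (\<Sum>s\<in>A. \<Sum>i\<in>UNIV. nat \<bar>p s i - p s0 i\<bar>)"
      using A that by (intro member_le_sum) simp_all
    finally have "nat \<bar>p s i - p s0 i\<bar> < N" by (simp add: N_def)
    then show ?thesis by linarith
  qed
  define g where "g s i = (\<Sum>k<N. cis (2 * pi * of_int (p s i - p s0 i) * real k / N)) / of_nat N" for s i
  define ind where "ind s = (\<Prod>i\<in>UNIV. g s i)" for s
  note g = cis_average[OF N, of "p _ i - p s0 i" for i, folded g_def]
  have ind_le: "norm (ind s) \<le> 1" for s
    unfolding ind_def prod_norm[symmetric] by (rule prod_le_1) (simp add: g(1))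
  have ind_s0: "ind s0 = 1" unfolding ind_def by (simp add: g(2))
  have ind_A: "ind s = 0" if s: "s \<in> A" "s \<noteq> s0" for s
  proof -
    have "p s \<noteq> p s0" using inj s s0 A(2) by (auto dest: inj_onD)
    then obtain i where "p s i - p s0 i \<noteq> 0" by auto
    then have "g s i = 0" using bound[OF s(1)] by (intro g(3))
    then show ?thesis unfolding ind_def by (meson finite_code prod_zero UNIV_I)
  qed
  define K where "K = (PiE UNIV (\<lambda>_ :: 'n. {..<N}))"
  have "finite K" unfolding K_def by (intro finite_PiE) simp_all
  \<comment> \<open>Multiplying the series by the conjugate character of \<open>p s0\<close> shifts
    all frequencies so that the one of \<open>s0\<close> becomes 0.\<close>
  have summand: "((\<lambda>s. b s * (\<Prod>i\<in>UNIV. cis (2 * pi * of_int (p s i - p s0 i) * real (h i) / N))) has_sum 0) S" for h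
  proof -
    have "(\<Prod>i\<in>UNIV. cis (2 * pi * of_int (p s i - p s0 i) * real (h i) / N))
       = cis (2 * pi * (\<Sum>i\<in>UNIV. of_int (p s i) * (real (h i) / N)))
         * cis (- 2 * pi * (\<Sum>i\<in>UNIV. of_int (p s0 i) * (real (h i) / N)))" for s
    proof -
      have "(\<Prod>i\<in>I. cis (\<theta> i)) = cis (\<Sum>i\<in>I. \<theta> i)" for \<theta> and I :: "'n set"
        by (induction I rule: infinite_finite_induct) (simp_all add: cis_mult)
      then show ?thesis
        by (simp add: cis_mult sum_distrib_left sum_subtractf[symmetric] sum_negf[symmetric] sum.distrib[symmetric] algebra_simps diff_divide_distrib)
    qed
    then show ?thesis
      using has_sum_cmult_left[OF sum0[of "\<lambda>i. real (h i) / N"],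
          of "cis (- 2 * pi * (\<Sum>i\<in>UNIV. of_int (p s0 i) * (real (h i) / N)))"]
      by (simp add: mult.assoc)
  qed
  have "((\<lambda>s. \<Sum>h\<in>K. b s * (\<Prod>i\<in>UNIV. cis (2 * pi * of_int (p s i - p s0 i) * real (h i) / N))) has_sum (\<Sum>h\<in>K. 0)) S"
    using \<open>finite K\<close> summand by (rule has_sum_finite_sum)
  moreover have "(\<Sum>h\<in>K. b s * (\<Prod>i\<in>UNIV. cis (2 * pi * of_int (p s i - p s0 i) * real (h i) / N)))
      = of_nat N ^ CARD('n) * (b s * ind s)" for s
  proof -
    have "(\<Sum>h\<in>K. b s * (\<Prod>i\<in>UNIV. cis (2 * pi * of_int (p s i - p s0 i) * real (h i) / N)))
        = b s * (\<Prod>i\<in>UNIV. \<Sum>k<N. cis (2 * pi * of_int (p s i - p s0 i) * real k / N))"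
      unfolding K_def sum_distrib_left[symmetric] by (subst prod_sum_PiE) simp_all
    moreover have "(\<Sum>k<N. cis (2 * pi * of_int (p s i - p s0 i) * real k / N)) = of_nat N * g s i" for i
      using N by (simp add: g_def)
    ultimately show ?thesis by (simp add: ind_def prod.distrib)
  qed
  ultimately have "((\<lambda>s. of_nat N ^ CARD('n) * (b s * ind s)) has_sum 0) S" by simp
  then have avg: "((\<lambda>s. b s * ind s) has_sum 0) S"
    using N has_sum_cmult_right[of _ S 0 "1 / of_nat N ^ CARD('n)"] by fastforce
  \<comment> \<open>Removing the term of \<open>s0\<close> leaves total \<open>- b s0\<close>. What
    remains vanishes on \<open>A\<close>, so the tail bound chosen above gives
    \<open>norm (b s0) <= norm (b s0) / 2\<close>.\<close>
  define f where "f s = (if s = s0 then 0 else b s * ind s)" for s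
  have "((\<lambda>s. if s = s0 then - b s0 else 0) has_sum (- b s0)) S"
    using s0 by (intro has_sum_finite_neutralI[of "{s0}"]) auto
  moreover have "f = (\<lambda>s. b s * ind s + (if s = s0 then - b s0 else 0))"
    by (simp add: fun_eq_iff f_def ind_s0)
  ultimately have "(f has_sum (- b s0)) S" using has_sum_add[OF avg] by fastforce
  moreover have "(f has_sum 0) A"
    using A(1) by (rule has_sum_finiteI) (rule sum.neutral[symmetric], simp add: f_def ind_A)
  ultimately have "(f has_sum (- b s0 - 0)) (S - A)" using A(2) by (rule has_sum_Diff)
  then have "norm (- b s0 - 0) \<le> norm (b s0) / 2"
  proof (rule tail)
    show "norm (f s) \<le> norm (b s)" for s
      using ind_le[of s] by (simp add: f_def norm_mult mult_left_le)
  qed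
  then show False using b0 by simp
qed

context even_negdef begin

text \<open>Restricting to the real translates of \<open>Z0\<close> gives a trigonometric series.
  Its frequencies are the pairings of \<open>l\<close> with the lattice basis: integral because
  \<open>l\<close> is dual, and determining \<open>l\<close> because the form is
  nondegenerate.\<close>

lemma tube_series_unique:
  assumes S: "S \<subseteq> dual BL1"
    and sum0: "\<And>Z. Z \<in> tube G0 \<Longrightarrow> ((\<lambda>l. b l * exp (2 * pi * \<i> * cform BL1 (cvec l) Z)) has_sum 0) S"
    and l: "l \<in> S"
  shows "b l = 0"
proof -
  define p where "p l i = \<lfloor>rform BL1 l (axis i 1)\<rfloor>" for l :: "real^'m idx1" and i
  define b' where "b' l = b l * exp (2 * pi * \<i> * cform BL1 (cvec l) Z0)" for l
  have p: "rform BL1 l (axis i 1) = of_int (p l i)" if "l \<in> S" for l i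
    using that S latt_closed(6)[of i] by (auto simp: p_def dual_def)
  have axis: "rform BL1 l X = (\<Sum>i\<in>UNIV. rform BL1 l (axis i 1) * X $ i)" for l X
    by (simp add: rform_sum axis_def if_distrib[of "\<lambda>c. _ * c"] sum_distrib_right cong: if_cong) (rule sum.swap)
  have "b' l = 0"
  proof (rule trigonometric_series_unique[where p = p and S = S])
    fix X :: "'m idx1 \<Rightarrow> real"
    define Z where "Z = Z0 + cvec (\<chi> i. X i)"
    have "ImV Z = ImV Z0" by (simp add: Z_def vec_eq_iff)
    then have Z: "Z \<in> tube G0" using ImV_Z0 by (simp add: tube_iff)
    have c: "cform BL1 (cvec l) Z = cform BL1 (cvec l) Z0 + of_real (\<Sum>i\<in>UNIV. of_int (p l i) * X i)" if "l \<in> S" for l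
    proof -
      have "ReV Z = ReV Z0 + (\<chi> i. X i)" by (simp add: Z_def vec_eq_iff)
      then have "rform BL1 l (ReV Z) = rform BL1 l (ReV Z0) + (\<Sum>i\<in>UNIV. of_int (p l i) * X i)"
        using axis[of l "\<chi> i. X i"] p[OF that] by (simp add: rform_add_right)
      then show ?thesis using \<open>ImV Z = ImV Z0\<close> by (simp add: cform_cvec_left)
    qed
    show "((\<lambda>l. b' l * cis (2 * pi * (\<Sum>i\<in>UNIV. of_int (p l i) * X i))) has_sum 0) S"
    proof (rule has_sum_cong[THEN iffD1, OF _ sum0[OF Z]])
      fix l assume "l \<in> S"
      then show "b l * exp (2 * pi * \<i> * cform BL1 (cvec l) Z)
          = b' l * cis (2 * pi * (\<Sum>i\<in>UNIV. of_int (p l i) * X i))"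
        unfolding b'_def cis_conv_exp c[OF \<open>l \<in> S\<close>]
        by (simp add: exp_add[symmetric] algebra_simps)
    qed
  next
    show "inj_on p S"
    proof (rule inj_onI)
      fix x y assume xy: "x \<in> S" "y \<in> S" "p x = p y"
      have "x - y = 0"
      proof (rule gramL1_nondegenerate)
        fix z
        have "rform BL1 x z = rform BL1 y z"
          unfolding axis[of x z] axis[of y z] using xy by (simp add: p)
        then show "rform BL1 (x - y) z = 0" by (simp add: rform_diff_left)
      qed
      then show "x = y" by simp
    qed
  qed (rule l)
  then show ?thesis by (simp add: b'_def)
qed

subsection \<open>The Koecher principle\<close>

lemma emb1_latt: "u \<in> latt \<Longrightarrow> emb1 u \<in> latt"
  unfolding latt_def
proof (intro CollectI allI)
  show "emb1 u $ i \<in> \<int>" if "u \<in> {v. \<forall>i. v $ i \<in> \<int>}" for i using that by (cases i) simp_all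
qed

lemma rform_emb1: "rform BL (emb1 u) x = rform BL1 u (proj1 x)"
  by (simp add: gramL_rform)

lemma transvection_emb1:
  fixes u a :: "real^'m idx1"
  defines "T \<equiv> transvection BL (emb1 u) (emb1 a)"
  shows "cmv T w $ E1 = w $ E1" "cmv T w $ F1 = w $ F1" "proj1 (cmv T w) = cmv (transvection BL1 u a) (proj1 w)"
proof -
  have T: "(T *v x) $ E1 = x $ E1" "(T *v x) $ F1 = x $ F1" "proj1 (T *v x) = transvection BL1 u a *v proj1 x" for x
    unfolding T_def
    by (simp_all add: transvection_apply[OF transpose_gramL] transvection_apply[OF transpose_gramL1]
        rform_emb1 vec_idx1_eq_iff)
  have c: "Re (cmv g w $ i) = (g *v ReV w) $ i" "Im (cmv g w $ i) = (g *v ImV w) $ i"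
    for g :: "real^'n^'n" and w i
    by (simp_all flip: cmv_ReIm)
  show "cmv T w $ E1 = w $ E1" "cmv T w $ F1 = w $ F1" by (simp_all add: complex_eq_iff c T)
  have "ReV (proj1 v) = proj1 (ReV v)" "ImV (proj1 v) = proj1 (ImV v)" for v :: "complex^'m idx"
    by (simp_all add: vec_idx1_eq_iff)
  then show "proj1 (cmv T w) = cmv (transvection BL1 u a) (proj1 w)"
    by (intro ReV_ImV_eqI) (simp_all add: cmv_ReIm T)
qed

text \<open>The lift fixes the first hyperbolic plane, and the quadratic \<open>E1\<close>-entry of
  \<open>wZ\<close> is preserved because the transvection of \<open>L1\<close> is an isometry. On
  the tube domain the lift is thus linear.\<close>

lemma transvection_wZ:
  assumes "rform BL1 u u = 0" "rform BL1 u a = 0"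
  shows "cmv (transvection BL (emb1 u) (emb1 a)) (wZ G0 Z) = wZ G0 (cmv (transvection BL1 u a) Z)"
proof -
  have eqI: "x = y" if "x $ E1 = y $ E1" "x $ F1 = y $ F1" "proj1 x = proj1 y" for x y :: "complex^'m idx"
    using that by (simp add: vec_idx_eq_iff vec_idx1_eq_iff)
  show ?thesis
    by (rule eqI)
      (simp_all add: transvection_emb1 isometry_cform[OF isometry_transvection[OF transpose_gramL1 assms]])
qed

lemma transvection1_dual:
  assumes u: "u \<in> latt" "rform BL1 u u = 0" and a: "a \<in> latt" "rform BL1 u a = 0"
    and l: "l \<in> dual BL1"
  shows "transvection BL1 u a *v l \<in> dual BL1"
  unfolding dual_def
proof (intro CollectI ballI)
  fix v :: "real^'m idx1" assume v: "v \<in> latt"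
  obtain m :: int where m: "rform BL1 a a = 2 * of_int m" using rform1_even[OF a(1)] by blast
  have "rform BL1 l v \<in> \<int>" "rform BL1 a l \<in> \<int>" "rform BL1 u l \<in> \<int>"
    using l v u a rform1_commute[of l] by (auto simp: dual_def)
  moreover have "rform BL1 a v \<in> \<int>" "rform BL1 u v \<in> \<int>"
    using u a v by (auto intro!: rform_latt_Ints gramL1_Ints)
  ultimately show "rform BL1 (transvection BL1 u a *v l) v \<in> \<int>"
    by (simp add: transvection_apply[OF transpose_gramL1] rform_linear m)
qed

text \<open>Contains both halves of the closed cone in the dual of \<open>L1\<close>.\<close>

definition index_set :: "(real^'m idx1) set" where
  "index_set = {l \<in> dual BL1. rform BL1 l l \<ge> 0}"

text \<open>\<open>F\<close> takes the same value at \<open>Z\<close> and at its image under the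
  lifted transvection. Reindexing the second expansion by the transvection turns it into another
  expansion at \<open>Z\<close>, and uniqueness compares coefficients.\<close>

lemma fourier_coefficient_invariant:
  assumes inv: "\<And>g w. g \<in> Otilde_plus G0 \<Longrightarrow> w \<in> coneP G0 \<Longrightarrow> F (cmv g w) = F w"
    and fourier: "\<And>Z. Z \<in> tube G0 \<Longrightarrow>
        ((\<lambda>l. a l * exp (2 * pi * \<i> * cform BL1 (cvec l) Z)) has_sum F (wZ G0 Z)) index_set"
    and u: "u \<in> latt" "rform BL1 u u = 0" and v: "v \<in> latt" "rform BL1 u v = 0"
    and l: "l \<in> index_set"
  shows "a (transvection BL1 u v *v l) = a l"
proof -
  define T where "T = transvection BL1 u v"
  have iso: "isometry BL1 T"
    unfolding T_def by (rule isometry_transvection[OF transpose_gramL1 u(2) v(2)])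
  have T_index: "transvection BL1 u c *v l \<in> index_set" if "l \<in> index_set" "c = v \<or> c = - v" for l c
  proof -
    have c: "c \<in> latt" "rform BL1 u c = 0" using that v by (auto simp: latt_closed rform_linear)
    have "isometry BL1 (transvection BL1 u c)" by (rule isometry_transvection[OF transpose_gramL1 u(2) c(2)])
    then show ?thesis using that(1) transvection1_dual[OF u c] by (simp add: index_set_def isometry_def)
  qed
  have bij: "bij_betw (\<lambda>l. T *v l) index_set index_set"
  proof (rule bij_betwI[where g = "\<lambda>l. transvection BL1 u (- v) *v l"])
    show "transvection BL1 u (- v) *v (T *v x) = x" for x
      unfolding T_def by (rule transvection_inverse[OF transpose_gramL1 u(2) v(2)])
    show "T *v (transvection BL1 u (- v) *v x) = x" for x
      using transvection_inverse[OF transpose_gramL1 u(2), of "- v" x] v(2) by (simp add: T_def rform_linear)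
  qed (auto simp: T_def T_index)
  have L: "transvection BL (emb1 u) (emb1 v) \<in> Otilde_plus G0"
    using u v by (intro transvection_Otilde_plus) (simp_all add: emb1_latt rform_emb1)
  have "a (T *v l) - a l = 0"
  proof (rule tube_series_unique[where S = index_set and b = "\<lambda>l. a (T *v l) - a l"])
    fix Z assume Z: "Z \<in> tube G0"
    define Z' where "Z' = cmv T Z"
    have w: "wZ G0 Z' = cmv (transvection BL (emb1 u) (emb1 v)) (wZ G0 Z)"
      unfolding Z'_def T_def by (rule transvection_wZ[OF u(2) v(2), symmetric])
    have P: "wZ G0 Z \<in> coneP G0" using Z by (simp add: tube_def)
    then have P': "wZ G0 Z' \<in> coneP G0"
      unfolding w using u(2) v(2) by (intro transvection_coneP) (simp_all add: rform_emb1)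
    then have "Z' \<in> tube G0"
      using coneP_subset by (auto simp: tube_def wZ_in_cone0_iff[symmetric])
    from fourier[OF this] have "((\<lambda>l. a l * exp (2 * pi * \<i> * cform BL1 (cvec l) Z')) has_sum F (wZ G0 Z)) index_set"
      unfolding w inv[OF L P] .
    then have "((\<lambda>l. a (T *v l) * exp (2 * pi * \<i> * cform BL1 (cvec (T *v l)) Z')) has_sum F (wZ G0 Z)) index_set"
      by (simp only: has_sum_reindex_bij_betw[OF bij, where f = "\<lambda>l. a l * exp (2 * pi * \<i> * cform BL1 (cvec l) Z')"])
    moreover have "cform BL1 (cvec (T *v l)) Z' = cform BL1 (cvec l) Z" for l
      unfolding Z'_def cmv_cvec[symmetric] by (rule isometry_cform[OF iso])
    ultimately have "((\<lambda>l. a (T *v l) * exp (2 * pi * \<i> * cform BL1 (cvec l) Z)) has_sum F (wZ G0 Z)) index_set"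
      by simp
    from has_sum_add[OF this has_sum_uminusI[OF fourier[OF Z]]]
    show "((\<lambda>l. (a (T *v l) - a l) * exp (2 * pi * \<i> * cform BL1 (cvec l) Z)) has_sum 0) index_set"
      by (simp add: algebra_simps)
  qed (use l in \<open>auto simp: index_set_def\<close>)
  then show ?thesis by (simp add: T_def)
qed

text \<open>If \<open>l\<close> lies in the negative cone, its orbit under the transvections fixing \<open>e2\<close> contributes
  infinitely many terms that are bounded away from zero.\<close>

lemma koecher:
  assumes inv: "\<And>g w. g \<in> Otilde_plus G0 \<Longrightarrow> w \<in> coneP G0 \<Longrightarrow> F (cmv g w) = F w"
    and fourier: "\<And>Z. Z \<in> tube G0 \<Longrightarrow>
        ((\<lambda>l. a l * exp (2 * pi * \<i> * cform BL1 (cvec l) Z)) has_sum F (wZ G0 Z)) index_set"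
    and l: "l \<in> index_set" "rform BL1 l l > 0" "l $ I1F < 0"
  shows "a l = 0"
proof (rule ccontr)
  assume al: "a l \<noteq> 0"
  \<comment> \<open>Any basis vector of \<open>L0\<close> will do; there is one because types are
    inhabited.\<close>
  define c :: 'm where "c = undefined"
  define u where "u = (axis I1E 1 :: real^'m idx1)"
  define v where "v j = real j *\<^sub>R (axis (I1V c) 1 :: real^'m idx1)" for j
  define T where "T j = transvection BL1 u (v j)" for j
  have u: "u \<in> latt" "rform BL1 u x = x $ I1F" for x
  proof -
    have "projV u = 0" by (simp add: u_def vec_eq_iff axis_def)
    then show "rform BL1 u x = x $ I1F" by (simp add: gramL1_rform) (simp add: u_def axis_def)
  qed (simp add: u_def latt_closed)
  have uF: "u $ I1F = 0" and vF: "v j $ I1F = 0" for j by (simp_all add: u_def v_def axis_def)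
  have v: "v j \<in> latt" for j unfolding v_def by (intro latt_closed) simp
  have inv_l: "a (T j *v l) = a l" for j
    unfolding T_def by (rule fourier_coefficient_invariant[OF inv fourier]) (simp_all add: u v uF vF l)
  have iso: "isometry BL1 (T j)" for j
    unfolding T_def by (rule isometry_transvection[OF transpose_gramL1]) (simp_all add: u uF vF)
  have index: "T j *v l \<in> index_set" for j
  proof -
    have "T j *v l \<in> dual BL1"
      unfolding T_def by (rule transvection1_dual) (use l in \<open>simp_all add: u v uF vF index_set_def\<close>)
    then show ?thesis using l iso[of j] by (simp add: index_set_def isometry_def)
  qed
  have F: "(T j *v l) $ I1F = l $ I1F" for j
    by (simp add: T_def transvection_apply[OF transpose_gramL1] uF vF)
  \<comment> \<open>The shift is linear in \<open>j\<close> with nonzero slope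
    \<open>l $ I1F\<close>, so the orbit is infinite.\<close>
  have V: "(T j *v l) $ I1V c = l $ I1V c + l $ I1F * real j" for j
    by (simp add: T_def transvection_apply[OF transpose_gramL1] u) (simp add: u_def v_def axis_def)
  have inj: "inj (\<lambda>j. T j *v l)"
  proof (rule injI)
    fix i j assume "T i *v l = T j *v l"
    then have "(T i *v l) $ I1V c = (T j *v l) $ I1V c" by simp
    then show "i = j" using l(3) by (simp add: V)
  qed
  have E: "(T j *v l) $ I1E < 0" for j
  proof -
    have "rform BL1 (- (T j *v l)) (- (T j *v l)) > 0"
      using iso[of j] l(2) by (simp add: isometry_def rform_linear)
    moreover have "(- (T j *v l)) $ I1F > 0" using l(3) F[of j] by simp
    ultimately have "(- (T j *v l)) $ I1E > 0" by (rule E_pos)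
    then show ?thesis by simp
  qed
  define t where "t x = a x * exp (2 * pi * \<i> * cform BL1 (cvec x) Z0)" for x
  have "t summable_on index_set"
    unfolding t_def using fourier[of Z0] ImV_Z0 by (auto simp: tube_iff intro: has_sum_imp_summable)
  then have "t summable_on (range (\<lambda>j. T j *v l))"
    by (rule summable_on_subset_banach) (use index in auto)
  then have "(\<lambda>j. t (T j *v l)) summable_on UNIV"
    using summable_on_reindex[OF inj, of t] by (simp add: o_def)
  then have "summable (\<lambda>j. t (T j *v l))" by (rule summable_on_imp_summable)
  then have "(\<lambda>j. t (T j *v l)) \<longlonglongrightarrow> 0" by (rule summable_LIMSEQ_zero)
  then obtain j where j: "norm (t (T j *v l)) < norm (a l)"
    using al by (auto simp: lim_sequentially dist_norm dest!: spec[of _ "norm (a l)"])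
  \<comment> \<open>The imaginary part of \<open>Z0\<close> is \<open>e2 + f2\<close>, so its
    pairing with an orbit element is the sum of two negative coordinates, and every exponential has
    absolute value at least 1.\<close>
  have "projV (ImV (Z0 :: complex^'m idx1)) = 0" by (simp add: vec_eq_iff Z0_def)
  then have "rform BL1 x (ImV Z0) = x $ I1E + x $ I1F" for x
    by (simp add: gramL1_rform Z0_def)
  then have "norm (t (T j *v l)) = norm (a l) * exp (- (2 * pi * ((T j *v l) $ I1E + (T j *v l) $ I1F)))"
    by (simp add: t_def norm_mult inv_l cform_cvec_left)
  moreover have "- (2 * pi * ((T j *v l) $ I1E + (T j *v l) $ I1F)) \<ge> 0"
    using E[of j] F[of j] l(3) by (simp add: mult_le_0_iff)
  ultimately have "norm (t (T j *v l)) \<ge> norm (a l)"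
    by (simp add: mult_le_cancel_left1)
  then show False using j by simp
qed

end

subsection \<open>Vanishing at the boundary\<close>

text \<open>Dominated convergence for unconditional sums: the tail is small uniformly in
  \<open>t\<close>, and the finite remainder tends to 0 termwise.\<close>

lemma tendsto_has_sum_dominated:
  fixes f :: "real \<Rightarrow> 's \<Rightarrow> complex"
  assumes summable: "(\<lambda>s. norm (b s)) summable_on S"
    and sum: "\<And>t. t \<ge> 0 \<Longrightarrow> (f t has_sum G t) S"
    and dom: "\<And>t s. t \<ge> 0 \<Longrightarrow> s \<in> S \<Longrightarrow> norm (f t s) \<le> norm (b s)"
    and lim: "\<And>s. s \<in> S \<Longrightarrow> ((\<lambda>t. f t s) \<longlongrightarrow> 0) at_top"
  shows "(G \<longlongrightarrow> 0) at_top"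
proof (rule tendstoI)
  fix \<epsilon> :: real assume \<epsilon>: "\<epsilon> > 0"
  obtain A where A: "finite A" "A \<subseteq> S" and tail:
    "\<And>(f :: 's \<Rightarrow> complex) x. (f has_sum x) (S - A) \<Longrightarrow> (\<And>s. s \<in> S - A \<Longrightarrow> norm (f s) \<le> norm (b s))
       \<Longrightarrow> norm x \<le> \<epsilon> / 2"
    by (rule dominated_tail[OF summable, of "\<epsilon> / 2"]) (use \<epsilon> in auto)
  have "((\<lambda>t. sum (f t) A) \<longlongrightarrow> (\<Sum>s\<in>A. 0)) at_top"
    using A lim by (intro tendsto_sum) auto
  then have "((\<lambda>t. sum (f t) A) \<longlongrightarrow> 0) at_top" by simp
  then have "eventually (\<lambda>t. dist (sum (f t) A) 0 < \<epsilon> / 2) at_top"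
    using \<epsilon> by (intro tendstoD) simp_all
  then show "eventually (\<lambda>t. dist (G t) 0 < \<epsilon>) at_top"
    using eventually_ge_at_top[of 0]
  proof eventually_elim
    case (elim t)
    have "(f t has_sum (G t - sum (f t) A)) (S - A)"
      using sum[OF elim(2)] A by (intro has_sum_Diff has_sum_finite)
    then have "norm (G t - sum (f t) A) \<le> \<epsilon> / 2"
      by (rule tail) (use dom elim(2) in auto)
    then show ?case using elim(1) norm_triangle_sub[of "G t" "sum (f t) A"] by simp
  qed
qed

lemma rational_multiple_latt:
  fixes x :: "real^'n"
  assumes "\<And>i. x $ i \<in> \<rat>"
  shows "\<exists>N::real. N \<noteq> 0 \<and> N *\<^sub>R x \<in> latt"
proof -
  have "\<exists>d::int. d \<noteq> 0 \<and> of_int d * x $ i \<in> \<int>" for i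
  proof -
    obtain m n :: int where "n > 0" "coprime m n" "x $ i = of_int m / of_int n" using assms[of i] by (rule Rats_cases')
    then show ?thesis by (intro exI[of _ n]) simp
  qed
  then obtain d :: "'n \<Rightarrow> int" where d: "d i \<noteq> 0" "of_int (d i) * x $ i \<in> \<int>" for i by metis
  define N :: real where "N = of_int (\<Prod>i\<in>UNIV. d i)"
  have "N * x $ i \<in> \<int>" for i
  proof -
    have "N * x $ i = of_int (\<Prod>j\<in>UNIV - {i}. d j) * (of_int (d i) * x $ i)"
      unfolding N_def by (subst prod.remove[of UNIV i]) simp_all
    then show ?thesis using d(2)[of i] by (metis Ints_mult Ints_of_int)
  qed
  then have "N *\<^sub>R x \<in> latt" by (simp add: latt_def)
  moreover have "N \<noteq> 0" using d(1) by (simp add: N_def)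
  ultimately show ?thesis by blast
qed

context even_negdef begin

text \<open>The vector moved to a multiple of \<open>e1\<close> is some combination of the two
  images under \<open>g\<close>, in general neither of them. The whole plane then lies in the
  orthogonal complement of \<open>e1\<close> and contains \<open>e1\<close>, so modulo
  \<open>e1\<close> it is the line of \<open>c'\<close>; hence the four coefficients.\<close>

lemma cusp_standard_form:
  assumes cyc: "iso_subgroups_cyclic BL" and g: "g \<in> OQ_plus G0"
    and c: "c \<noteq> 0" "c \<in> latt" "rform BL1 c c = 0"
  shows "\<exists>\<gamma>\<in>Otilde_plus G0. \<exists>c' \<alpha>1 \<alpha>2 \<beta>1 \<beta>2. rform BL1 c' c' = 0
    \<and> (\<gamma> ** g) *v axis E1 1 = \<alpha>1 *\<^sub>R axis E1 1 + emb1 (\<beta>1 *\<^sub>R c')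
    \<and> (\<gamma> ** g) *v emb1 c = \<alpha>2 *\<^sub>R axis E1 1 + emb1 (\<beta>2 *\<^sub>R c')"
proof -
  let ?e = "axis E1 1 :: real^'m idx"
  have e: "rform BL x ?e = x $ F1" "rform BL ?e x = x $ F1" for x
  proof -
    have "proj1 ?e = 0" by (simp add: vec_idx1_eq_iff axis_def)
    then show "rform BL x ?e = x $ F1" "rform BL ?e x = x $ F1"
      by (simp_all add: gramL_rform) (simp_all add: axis_def)
  qed
  define p1 p2 where "p1 = g *v ?e" and "p2 = g *v emb1 c"
  have iso: "rform BL (g *v x) (g *v y) = rform BL x y" for x y
    using g by (simp add: OQ_plus_def isometry_iff[symmetric] isometry_def)
  have orth: "rform BL p1 p1 = 0" "rform BL p1 p2 = 0" "rform BL p2 p1 = 0" "rform BL p2 p2 = 0"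
    unfolding p1_def p2_def iso by (simp_all add: e rform_emb1 c) (simp add: axis_def)
  have indep: "r = 0 \<and> s = 0" if "r *\<^sub>R p1 + s *\<^sub>R p2 = 0" for r s
  proof -
    define x where "x = r *\<^sub>R ?e + s *\<^sub>R emb1 c"
    have "g *v x = 0" using that
      by (simp add: x_def p1_def p2_def matrix_vector_right_distrib matrix_vector_mult_scaleR)
    then have "rform BL x y = 0" for y using iso[of x y] by simp
    then have x: "x = 0" by (rule gramL_nondegenerate)
    have "x $ E1 = r" by (simp add: x_def axis_def)
    then have r: "r = 0" using x by simp
    have "proj1 x = s *\<^sub>R c" by (simp add: x_def axis_def vec_idx1_eq_iff)
    then have "s *\<^sub>R c = 0" using x by (simp add: vec_idx1_eq_iff)
    then show ?thesis using r c(1) by simp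
  qed
  have rat: "(g *v x) $ i \<in> \<rat>" if "x \<in> latt" for x i
  proof -
    have "x $ j \<in> \<rat>" for j using that by (auto simp: latt_def elim!: Ints_cases dest!: spec[of _ j])
    moreover have "g $ i $ j \<in> \<rat>" for j using g by (simp add: OQ_plus_def)
    ultimately show ?thesis by (auto simp: matrix_vector_mult_def intro!: Rats_sum Rats_mult)
  qed
  \<comment> \<open>\<open>g\<close> is only rational; clearing denominators provides independent
    lattice vectors in the plane.\<close>
  obtain N1 N2 where N: "N1 \<noteq> 0" "N1 *\<^sub>R p1 \<in> latt" "N2 \<noteq> 0" "N2 *\<^sub>R p2 \<in> latt"
    using rational_multiple_latt[of p1] rational_multiple_latt[of p2] rat[of ?e] rat[of "emb1 c"] c(2)
    by (metis p1_def p2_def latt_closed(6) emb1_latt)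
  define P where "P = {r *\<^sub>R p1 + s *\<^sub>R p2 |r s. True}"
  have P_sub: "subspace P"
    unfolding subspace_def
  proof (intro conjI ballI allI)
    show "0 \<in> P" unfolding P_def by (intro CollectI exI[of _ 0]) simp
  next
    fix x y assume "x \<in> P" "y \<in> P"
    then obtain r s r' s' where "x = r *\<^sub>R p1 + s *\<^sub>R p2" "y = r' *\<^sub>R p1 + s' *\<^sub>R p2" by (auto simp: P_def)
    then have "x + y = (r + r') *\<^sub>R p1 + (s + s') *\<^sub>R p2" by (simp add: algebra_simps)
    then show "x + y \<in> P" unfolding P_def by blast
  next
    fix x and k :: real assume "x \<in> P"
    then obtain r s where "x = r *\<^sub>R p1 + s *\<^sub>R p2" by (auto simp: P_def)
    then have "k *\<^sub>R x = (k * r) *\<^sub>R p1 + (k * s) *\<^sub>R p2" by (simp add: algebra_simps)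
    then show "k *\<^sub>R x \<in> P" unfolding P_def by blast
  qed
  have "\<exists>e\<in>P \<inter> latt. \<exists>v\<in>latt. rform BL e v = 1"
  proof (rule isotropic_unimodular_vector[OF cyc P_sub])
    show "rform BL x y = 0" if "x \<in> P" "y \<in> P" for x y
      using that by (auto simp: P_def rform_linear orth)
    have "p1 = 1 *\<^sub>R p1 + 0 *\<^sub>R p2" "p2 = 0 *\<^sub>R p1 + 1 *\<^sub>R p2" by simp_all
    then have "p1 \<in> P" "p2 \<in> P" unfolding P_def by blast+
    then show "N1 *\<^sub>R p1 \<in> P" "N2 *\<^sub>R p2 \<in> P" using P_sub by (simp_all add: subspace_scale)
    show "r = 0 \<and> s = 0" if "r *\<^sub>R N1 *\<^sub>R p1 + s *\<^sub>R N2 *\<^sub>R p2 = 0" for r s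
      using indep[of "r * N1" "s * N2"] that N by simp
  qed (use N in auto)
  then obtain x v where x: "x \<in> P" "x \<in> latt" and v: "v \<in> latt" "rform BL x v = 1" by blast
  obtain \<alpha> \<beta> where x_eq: "x = \<alpha> *\<^sub>R p1 + \<beta> *\<^sub>R p2" using x(1) by (auto simp: P_def)
  have "rform BL x x = 0" by (simp add: x_eq rform_linear orth)
  from eichler_criterion[OF x(2) this v] obtain \<gamma> \<epsilon> where
    \<gamma>: "\<gamma> \<in> Otilde_plus G0" and \<epsilon>: "\<epsilon> \<noteq> 0" "\<gamma> *v x = \<epsilon> *\<^sub>R ?e" by blast
  define r1 r2 where "r1 = \<gamma> *v p1" and "r2 = \<gamma> *v p2"
  have \<gamma>_iso: "rform BL (\<gamma> *v x) (\<gamma> *v y) = rform BL x y" for x y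
    using Otilde_plus_isometry[OF \<gamma>] by (simp add: isometry_def)
  have rel: "\<alpha> *\<^sub>R r1 + \<beta> *\<^sub>R r2 = \<epsilon> *\<^sub>R ?e"
    using \<epsilon>(2) by (simp add: x_eq r1_def r2_def matrix_vector_right_distrib matrix_vector_mult_scaleR)
  have orth': "rform BL r1 r1 = 0" "rform BL r1 r2 = 0" "rform BL r2 r1 = 0" "rform BL r2 r2 = 0"
    unfolding r1_def r2_def \<gamma>_iso by (rule orth)+
  have "rform BL r1 (\<epsilon> *\<^sub>R ?e) = 0" "rform BL r2 (\<epsilon> *\<^sub>R ?e) = 0"
    unfolding rel[symmetric] by (simp_all add: rform_linear orth')
  then have F: "r1 $ F1 = 0" "r2 $ F1 = 0" using \<epsilon>(1) by (simp_all add: rform_linear e)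
  have dec: "r = (r $ E1) *\<^sub>R ?e + emb1 (proj1 r)" if "r $ F1 = 0" for r :: "real^'m idx"
    using that by (simp add: vec_idx_eq_iff axis_def)
  have n: "rform BL1 (proj1 r1) (proj1 r1) = 0" "rform BL1 (proj1 r2) (proj1 r2) = 0"
    using orth' F by (simp_all add: gramL_rform)
  have rel1: "\<alpha> *\<^sub>R proj1 r1 + \<beta> *\<^sub>R proj1 r2 = 0"
  proof -
    have "proj1 (\<alpha> *\<^sub>R r1 + \<beta> *\<^sub>R r2) = 0" unfolding rel by (simp add: vec_idx1_eq_iff axis_def)
    moreover have "proj1 (\<alpha> *\<^sub>R r1 + \<beta> *\<^sub>R r2) = \<alpha> *\<^sub>R proj1 r1 + \<beta> *\<^sub>R proj1 r2"
      by (simp add: vec_idx1_eq_iff)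
    ultimately show ?thesis by simp
  qed
  \<comment> \<open>By \<open>rel1\<close> the two projections are dependent. If \<alpha> is 0, the
    second one vanishes and the first serves as \<open>c'\<close>; otherwise the first is a multiple
    of the second.\<close>
  have "\<exists>c' \<beta>1 \<beta>2. rform BL1 c' c' = 0 \<and> proj1 r1 = \<beta>1 *\<^sub>R c' \<and> proj1 r2 = \<beta>2 *\<^sub>R c'"
  proof (cases "\<alpha> = 0")
    case True
    then have "\<beta> \<noteq> 0" using rel \<epsilon>(1) by (auto simp: axis_eq_0_iff)
    then have "proj1 r2 = 0 *\<^sub>R proj1 r1" using rel1 True by simp
    then show ?thesis using n(1) by (intro exI[of _ "proj1 r1"] exI[of _ 1] exI[of _ 0]) simp
  next
    case False
    have "\<alpha> *\<^sub>R proj1 r1 = - (\<beta> *\<^sub>R proj1 r2)" using rel1 by (simp add: add_eq_0_iff2)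
    then have "(1 / \<alpha>) *\<^sub>R \<alpha> *\<^sub>R proj1 r1 = (1 / \<alpha>) *\<^sub>R (- (\<beta> *\<^sub>R proj1 r2))" by simp
    then have "proj1 r1 = (- \<beta> / \<alpha>) *\<^sub>R proj1 r2" using False by simp
    then show ?thesis using n(2) by (intro exI[of _ "proj1 r2"] exI[of _ "- \<beta> / \<alpha>"] exI[of _ 1]) simp
  qed
  then obtain c' \<beta>1 \<beta>2 where c': "rform BL1 c' c' = 0" "proj1 r1 = \<beta>1 *\<^sub>R c'" "proj1 r2 = \<beta>2 *\<^sub>R c'" by blast
  have "r1 = (\<gamma> ** g) *v ?e" "r2 = (\<gamma> ** g) *v emb1 c"
    by (simp_all add: r1_def r2_def p1_def p2_def matrix_vector_mul_assoc)
  then have "(\<gamma> ** g) *v ?e = (r1 $ E1) *\<^sub>R ?e + emb1 (\<beta>1 *\<^sub>R c')"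
    "(\<gamma> ** g) *v emb1 c = (r2 $ E1) *\<^sub>R ?e + emb1 (\<beta>2 *\<^sub>R c')"
    using dec[OF F(1), unfolded c'(2)] dec[OF F(2), unfolded c'(3)] by metis+
  then show ?thesis using \<gamma> c'(1) by blast
qed

lemma closure_poscone: "c \<in> closure poscone \<Longrightarrow> c $ I1E \<ge> 0 \<and> c $ I1F \<ge> 0"
proof -
  have "poscone \<subseteq> {c. c $ I1E \<ge> 0 \<and> c $ I1F \<ge> 0}"
    using E_pos by (force simp: poscone_def)
  moreover have "closed {c :: real^'m idx1. c $ I1E \<ge> 0 \<and> c $ I1F \<ge> 0}"
    by (intro closed_Collect_conj closed_Collect_le continuous_intros)
  ultimately have "closure poscone \<subseteq> {c. c $ I1E \<ge> 0 \<and> c $ I1F \<ge> 0}" by (rule closure_minimal)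
  then show "c \<in> closure poscone \<Longrightarrow> c $ I1E \<ge> 0 \<and> c $ I1F \<ge> 0" by blast
qed

text \<open>The term quadratic in \<open>t\<close> disappears because \<open>c\<close> is isotropic,
  so the curve in the cone is a straight line with direction in the plane of \<open>emb1 c\<close>
  and \<open>e1\<close>. The coefficient \<kappa> is minus the pairing of \<open>Z\<close> with
  \<open>c\<close>.\<close>

lemma wZ_ray:
  assumes "rform BL1 c c = 0"
  shows "\<exists>\<kappa>. \<forall>t. wZ G0 (Z + cscale t (cvec c))
    = wZ G0 Z + (cscale t (cvec (emb1 c)) + cscale (t * \<kappa>) (cvec (axis E1 1)))"
proof (intro exI allI)
  fix t
  let ?\<kappa> = "- (cform BL1 Z (cvec c) + cform BL1 (cvec c) Z) / 2"
  have "ReV (cvec c) = c" "ImV (cvec c) = 0" by (simp_all add: vec_eq_iff)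
  then have "cform BL1 (cvec c) (cvec c) = 0" using assms by (simp add: cform_cvec_left)
  then show "wZ G0 (Z + cscale t (cvec c))
    = wZ G0 Z + (cscale t (cvec (emb1 c)) + cscale (t * ?\<kappa>) (cvec (axis E1 1)))"
    by (simp add: vec_idx_eq_iff cform_add_left cform_add_right cform_scale_left cform_scale_right axis_def field_simps)
qed

lemma vanishes_at_boundary:
  assumes cyc: "iso_subgroups_cyclic BL"
    and homog: "\<And>w t. w \<in> coneP G0 \<Longrightarrow> t \<noteq> 0 \<Longrightarrow> F (cscale t w) = t powi (- k) * F w"
    and inv: "\<And>g w. g \<in> Otilde_plus G0 \<Longrightarrow> w \<in> coneP G0 \<Longrightarrow> F (cmv g w) = F w"
    and fourier: "\<And>Z. Z \<in> tube G0 \<Longrightarrow>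
        ((\<lambda>l. a l * exp (2 * pi * \<i> * cform BL1 (cvec l) Z)) has_sum F (wZ G0 Z)) index_set"
    and van: "\<And>l. l \<in> index_set \<Longrightarrow> rform BL1 l l = 0 \<Longrightarrow> a l = 0"
  shows "vanishes_at_boundary G0 F"
  unfolding vanishes_at_boundary_def
proof (intro ballI allI impI, elim conjE)
  fix g Z and c :: "real^'m idx1"
  assume g: "g \<in> OQ_plus G0" and Z: "Z \<in> tube G0"
    and c: "c \<noteq> 0" "c \<in> latt" "rform BL1 c c = 0" "c \<in> closure (posC G0)"
  obtain \<gamma> c' \<alpha>1 \<alpha>2 \<beta>1 \<beta>2 where \<gamma>: "\<gamma> \<in> Otilde_plus G0" and c': "rform BL1 c' c' = 0"
    and h: "(\<gamma> ** g) *v axis E1 1 = \<alpha>1 *\<^sub>R axis E1 1 + emb1 (\<beta>1 *\<^sub>R c')"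
      "(\<gamma> ** g) *v emb1 c = \<alpha>2 *\<^sub>R axis E1 1 + emb1 (\<beta>2 *\<^sub>R c')"
    using cusp_standard_form[OF cyc g c(1-3)] by blast
  define Y where "Y = ImV Z"
  have Y: "rform BL1 Y Y > 0" "Y $ I1F > 0" using Z by (simp_all add: tube_iff poscone_def Y_def)
  have c_nonneg: "c $ I1E \<ge> 0" "c $ I1F \<ge> 0" using c(4) closure_poscone by (simp_all add: posC_eq)
  have Yc: "rform BL1 Y c > 0" using Y c_nonneg c by - (rule cone_pairing_pos, simp_all)

  define W where "W t = wZ G0 (Z + cscale (\<i> * complex_of_real t) (cvec c))" for t
  have Im: "ImV (Z + cscale (\<i> * complex_of_real t) (cvec c)) = Y + t *\<^sub>R c" for t
    by (simp add: Y_def vec_eq_iff)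
  have norm_Yt: "rform BL1 (Y + t *\<^sub>R c) (Y + t *\<^sub>R c) = rform BL1 Y Y + 2 * t * rform BL1 Y c" for t
    using c(3) rform1_commute[of c Y] by (simp add: rform_linear)
  have W_cone: "W t \<in> coneP G0" if "t \<ge> 0" for t
  proof -
    have "Y + t *\<^sub>R c \<in> poscone"
      using Y Yc c_nonneg that by (simp add: poscone_def norm_Yt add_pos_nonneg)
    then have "Z + cscale (\<i> * complex_of_real t) (cvec c) \<in> tube G0" by (simp add: tube_iff Im)
    then show ?thesis by (simp add: W_def tube_def)
  qed
  obtain \<kappa> where ray: "\<And>t. W t = wZ G0 Z + (cscale (\<i> * complex_of_real t) (cvec (emb1 c))
      + cscale (\<i> * complex_of_real t * \<kappa>) (cvec (axis E1 1)))"
    using wZ_ray[OF c(3), of Z] unfolding W_def by blast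

  define w where "w t = cmv (\<gamma> ** g) (W t)" for t
  \<comment> \<open>The coefficient of \<open>c'\<close>, modulo \<open>e1\<close>, in the image of
    the direction \<open>emb1 c\<close> plus \<kappa> times \<open>e1\<close>.\<close>
  define \<nu> where "\<nu> = \<beta>2 + \<kappa> * \<beta>1"
  define \<mu> where "\<mu> = w 0 $ F1"
  have gW: "cmv g (W t) \<in> coneP G0" if "t \<ge> 0" for t
    using g W_cone[OF that] unfolding OQ_plus_def by blast
  have w_cone: "w t \<in> coneP G0" if "t \<ge> 0" for t
    using \<gamma> gW[OF that] unfolding Otilde_plus_def w_def cmv_mult by blast
  have w_ray: "w t = cmv (\<gamma> ** g) (wZ G0 Z) + (cscale (\<i> * complex_of_real t) (cvec ((\<gamma> ** g) *v emb1 c))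
      + cscale (\<i> * complex_of_real t * \<kappa>) (cvec ((\<gamma> ** g) *v axis E1 1)))" for t
    unfolding w_def ray by (simp add: cmv_add cmv_scale cmv_cvec)
  have w_F1: "w t $ F1 = \<mu>" for t
    unfolding \<mu>_def w_ray h by (simp add: axis_def)
  have w_proj: "proj1 (w t) = proj1 (w 0) + cscale (\<i> * complex_of_real t * \<nu>) (cvec c')" for t
    unfolding w_ray h \<nu>_def by (simp add: axis_def vec_idx1_eq_iff algebra_simps)
  have \<mu>: "\<mu> \<noteq> 0" using coneP_wZ(1)[OF w_cone[of 0]] by (simp add: \<mu>_def)

  define Z' where "Z' t = cscale (1 / \<mu>) (proj1 (w t))" for t
  \<comment> \<open>Only the real part of \<open>\<nu> / \<mu>\<close> moves the imaginary part of
    \<open>Z'\<close>. The imaginary part of this quotient translates \<open>Z'\<close> in a real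
    direction and does not affect the absolute values of the Fourier terms.\<close>
  define r where "r = Re (\<nu> / \<mu>)"
  define Y' where "Y' = ImV (Z' 0)"
  define d where "d = r *\<^sub>R c'"
  have Z'_tube: "Z' t \<in> tube G0" and w_eq: "w t = cscale \<mu> (wZ G0 (Z' t))" if "t \<ge> 0" for t
    using coneP_wZ(2,3)[OF w_cone[OF that]] by (simp_all add: Z'_def w_F1)
  have Z'_ray: "Z' t = Z' 0 + cscale (\<i> * complex_of_real t * (\<nu> / \<mu>)) (cvec c')" for t
    unfolding Z'_def w_proj[of t] by (simp add: vec_eq_iff add_divide_distrib mult.assoc)
  have Im': "ImV (Z' t) = Y' + t *\<^sub>R d" for t
  proof -
    have "Im (\<i> * complex_of_real t * q * complex_of_real y) = t * Re q * y" for q y by simp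
    from this[of "\<nu> / \<mu>"] show ?thesis
      unfolding Z'_ray[of t] Y'_def d_def r_def by (simp add: vec_eq_iff del: times_divide_eq_right)
  qed
  have norm_Y't: "(cmod \<mu>)\<^sup>2 * rform BL1 (Y' + t *\<^sub>R d) (Y' + t *\<^sub>R d) = rform BL1 (Y + t *\<^sub>R c) (Y + t *\<^sub>R c)"
    if "t \<ge> 0" for t
  proof -
    have "isometry BL (\<gamma> ** g)"
      using g Otilde_plus_isometry[OF \<gamma>] by (intro isometry_mult) (simp_all add: OQ_plus_def isometry_iff)
    then have "cform BL (w t) (cconj (w t)) = cform BL (W t) (cconj (W t))"
      unfolding w_def by (simp add: cmv_cconj[symmetric] isometry_cform)
    moreover have "cform BL (W t) (cconj (W t)) = complex_of_real (2 * rform BL1 (Y + t *\<^sub>R c) (Y + t *\<^sub>R c))"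
      unfolding W_def cform_wZ_conj Im ..
    moreover have "cform BL (w t) (cconj (w t))
        = complex_of_real ((cmod \<mu>)\<^sup>2) * complex_of_real (2 * rform BL1 (Y' + t *\<^sub>R d) (Y' + t *\<^sub>R d))"
    proof -
      have "cconj (cscale s v) = cscale (cnj s) (cconj v)" for s and v :: "complex^'m idx"
        by (simp add: vec_eq_iff)
      then show ?thesis unfolding w_eq[OF that] complex_norm_square
        by (simp only: cform_scale cform_wZ_conj Im')
    qed
    ultimately have "complex_of_real ((cmod \<mu>)\<^sup>2 * (2 * rform BL1 (Y' + t *\<^sub>R d) (Y' + t *\<^sub>R d)))
        = complex_of_real (2 * rform BL1 (Y + t *\<^sub>R c) (Y + t *\<^sub>R c))"
      by (simp only: of_real_mult)
    then have "(cmod \<mu>)\<^sup>2 * (2 * rform BL1 (Y' + t *\<^sub>R d) (Y' + t *\<^sub>R d)) = 2 * rform BL1 (Y + t *\<^sub>R c) (Y + t *\<^sub>R c)"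
      by (simp only: of_real_eq_iff)
    then show ?thesis by simp
  qed
  have dd: "rform BL1 d d = 0" using c' by (simp add: d_def rform_linear)
  \<comment> \<open>Both norms are affine in \<open>t\<close>; comparing \<open>t = 0\<close> with
    \<open>t = 1\<close> isolates the slopes and carries the positivity of \<open>(Y, c)\<close>
    over to \<open>(Y', d)\<close>.\<close>
  have "rform BL1 (Y' + 1 *\<^sub>R d) (Y' + 1 *\<^sub>R d) = rform BL1 Y' Y' + 2 * rform BL1 Y' d"
    using dd rform1_commute[of d Y'] by (simp add: rform_linear)
  with norm_Y't[of 0] norm_Y't[of 1] norm_Yt[of 1]
  have "(cmod \<mu>)\<^sup>2 * rform BL1 Y' d = rform BL1 Y c" by (simp add: distrib_left)
  then have "(cmod \<mu>)\<^sup>2 * rform BL1 Y' d > 0" using Yc by simp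
  then have Y'd: "rform BL1 Y' d > 0" by (simp add: zero_less_mult_iff)
  have Y': "rform BL1 Y' Y' > 0" "Y' $ I1F > 0"
    using Z'_tube[of 0] by (simp_all add: tube_iff poscone_def Y'_def)
  have d0: "d \<noteq> 0" using Y'd by auto
  have d_nonneg: "d $ I1E \<ge> 0 \<and> d $ I1F \<ge> 0"
  proof (rule ccontr)
    assume "\<not> ?thesis"
    then have "(- d) $ I1E \<ge> 0" "(- d) $ I1F \<ge> 0" using isotropic_cone_sign[OF dd] by auto
    then have "rform BL1 Y' (- d) > 0"
      using Y' d0 dd by - (rule cone_pairing_pos, simp_all add: rform_linear)
    then show False using Y'd by (simp add: rform_linear)
  qed
  \<comment> \<open>A nonzero coefficient forces \<open>(l, l) > 0\<close>, so \<open>l\<close> is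
    not orthogonal to \<open>e2\<close>; the Koecher principle rules out the negative half of the
    cone.\<close>
  have ld: "rform BL1 l d > 0" if l: "l \<in> index_set" "a l \<noteq> 0" for l
  proof -
    have pos: "rform BL1 l l > 0" using l van by (force simp: index_set_def)
    then have "l $ I1F \<noteq> 0" using rform1_nonpos(1)[of l] by auto
    moreover have "\<not> l $ I1F < 0" using koecher[OF inv fourier l(1) pos] l(2) by blast
    ultimately have "l $ I1F > 0" by simp
    then show ?thesis using pos d_nonneg d0 dd by - (rule cone_pairing_pos, simp_all)
  qed

  define f where "f t l = a l * exp (2 * pi * \<i> * cform BL1 (cvec l) (Z' t))" for t l
  have f_sum: "(f t has_sum F (wZ G0 (Z' t))) index_set" if "t \<ge> 0" for t
    unfolding f_def by (rule fourier[OF Z'_tube[OF that]])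
  have f_norm: "norm (f t l) = norm (f 0 l) * exp (- (2 * pi * rform BL1 l d) * t)" for t l
    by (simp add: f_def norm_mult cform_cvec_left Im' rform_linear exp_add[symmetric] algebra_simps)
  have "((\<lambda>t. F (wZ G0 (Z' t))) \<longlongrightarrow> 0) at_top"
  proof (rule tendsto_has_sum_dominated[where f = f and b = "f 0"])
    have "f 0 summable_on index_set" using f_sum[of 0] by (auto intro: has_sum_imp_summable)
    then show "(\<lambda>l. norm (f 0 l)) summable_on index_set"
      by (simp add: summable_on_iff_abs_summable_on_complex[symmetric])
    show "norm (f t l) \<le> norm (f 0 l)" if "t \<ge> 0" "l \<in> index_set" for t l
    proof (cases "a l = 0")
      case False
      then have "exp (- (2 * pi * rform BL1 l d) * t) \<le> 1" using ld[OF that(2)] that(1) by simp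
      then show ?thesis using f_norm[of t l] by (simp add: mult_left_le)
    qed (simp add: f_def)
    show "((\<lambda>t. f t l) \<longlongrightarrow> 0) at_top" if "l \<in> index_set" for l
    proof (cases "a l = 0")
      case False
      define q where "q = 2 * pi * rform BL1 l d"
      have "q > 0" using ld[OF that False] by (simp add: q_def)
      then have "((\<lambda>t. norm (f 0 l) * exp (- q * t)) \<longlongrightarrow> 0) at_top" by real_asymp
      then have "((\<lambda>t. norm (f t l)) \<longlongrightarrow> 0) at_top"
        unfolding q_def by (simp only: f_norm[symmetric])
      then show ?thesis by (rule tendsto_norm_zero_cancel)
    qed (simp add: f_def)
  qed (rule f_sum)
  then have "((\<lambda>t. \<mu> powi (- k) * F (wZ G0 (Z' t))) \<longlongrightarrow> \<mu> powi (- k) * 0) at_top"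
    by (rule tendsto_mult_left)
  moreover have "\<mu> powi (- k) * F (wZ G0 (Z' t)) = F (cmv g (W t))" if "t \<ge> 0" for t
  proof -
    have "wZ G0 (Z' t) \<in> coneP G0" using Z'_tube[OF that] by (simp add: tube_def)
    then have "F (w t) = \<mu> powi (- k) * F (wZ G0 (Z' t))"
      unfolding w_eq[OF that] using \<mu> by (rule homog)
    moreover have "F (w t) = F (cmv g (W t))"
      unfolding w_def cmv_mult by (rule inv[OF \<gamma> gW[OF that]])
    ultimately show ?thesis by simp
  qed
  then have "eventually (\<lambda>t. \<mu> powi (- k) * F (wZ G0 (Z' t)) = F (cmv g (W t))) at_top"
    by (auto intro: eventually_mono[OF eventually_ge_at_top[of 0]])
  ultimately have "((\<lambda>t. F (cmv g (W t))) \<longlongrightarrow> 0) at_top"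
    by (simp add: tendsto_cong)
  then show "((\<lambda>t. F (cmv g (wZ G0 (Z + cscale (\<i> * complex_of_real t) (cvec c))))) \<longlongrightarrow> 0) at_top"
    unfolding W_def .
qed

end

theorem theorem5p2:
  fixes G0 :: "int^'m^'m" and k :: int
    and F :: "complex^('m::finite idx) \<Rightarrow> complex"
    and a :: "real^('m idx1) \<Rightarrow> complex"
  assumes sym: "transpose G0 = G0"
    and even: "\<forall>i. even (G0 $ i $ i)"
    and negdef: "\<forall>x::real^'m. x \<noteq> 0 \<longrightarrow> rform (map_matrix real_of_int G0) x x < 0"
    and cyc: "iso_subgroups_cyclic (gramL G0)"
    and mf: "modular_form G0 k F"
    and fourier: "\<forall>Z\<in>tube G0.
        ((\<lambda>l. a l * exp (2 * pi * \<i> * cform (gramL1 G0) (cvec l) Z)) has_sum F (wZ G0 Z))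
          {l \<in> dual (gramL1 G0). rform (gramL1 G0) l l \<ge> 0}"
    and van: "\<forall>l\<in>dual (gramL1 G0). rform (gramL1 G0) l l = 0 \<longrightarrow> a l = 0"
  shows "cusp_form G0 k F"
proof -
  interpret even_negdef G0
    by unfold_locales (rule sym even negdef)+
  have "vanishes_at_boundary G0 F"
  proof (rule vanishes_at_boundary[where k = k and a = a, OF cyc])
    show "((\<lambda>l. a l * exp (2 * pi * \<i> * cform (gramL1 G0) (cvec l) Z)) has_sum F (wZ G0 Z)) index_set"
      if "Z \<in> tube G0" for Z
      using fourier that by (simp add: index_set_def)
  qed (use mf van in \<open>auto simp: modular_form_def index_set_def\<close>)
  then show ?thesis using mf by (simp add: cusp_form_def)
qed

end
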